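(* Suppose Assumptions A1, A2, A3 (stated in the context) hold. Then there is a constant $M>0$ such that in the closed-loop system described in the context, $$\liminf_{t\to+\infty}\frac{\lambda_{\min}(t+1)}{t}\ \ge\ M\,\liminf_{t\to+\infty}\frac1t\sum_{i=1}^t\frac1{\sigma_{i-1}}\quad\text{almost surely.}$$
   Context: Setting: $n\ge2$; $\theta=(\theta_1,\ldots,\theta_n)^\tau\in\mathbb{R}^n$ is an unknown (random) parameter vector; $\phi=(f_1,\ldots,f_n)^\tau:\mathbb{R}\to\mathbb{R}^n$ is a known measurable vector function, and $E\subset\mathbb{R}$ is an open set such that $f_j\in C^n(E)$ for $1\le j\le n$. The system is $$y_{t+1}=\theta^\tau\phi(y_t)+u_t+w_{t+1},\quad t\ge0,$$ with initial condition $y_0\in\mathbb{R}$ arbitrary. Assumptions. A1: $\{w_t\}$ is an i.i.d. random sequence with $w_1\sim N(0,\sigma^2)$, $\sigma>0$. A2: $\theta\sim N(\theta_0,I_n)$ is independent of $\{w_t\}$. A3: $f_1,\ldots,f_n$ are linearly independent on $E$. Closed-loop system: with $\phi_t:=\phi(y_t)$, the least-squares (LS) estimate $\hat\theta_t$ and the matrices $P_t$ are defined by $\hat\theta_0=\theta_0$, $P_0=I_n$, $$\hat\theta_{t+1}=\hat\theta_t+\sigma^{-2}P_{t+1}\phi_t(y_{t+1}-u_t-\phi_t^\tau\hat\theta_t),\qquad P_{t+1}=P_t-(\sigma^2+\phi_t^\tau P_t\phi_t)^{-1}P_t\phi_t\phi_t^\tau P_t,$$ and the control is $u_t=-\hat\theta_t^\tau\phi_t$,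 $t\ge0$. Equivalently $P_{t+1}^{-1}=I_n+\frac1{\sigma^2}\sum_{i=0}^t\phi_i\phi_i^\tau$. $\lambda_{\min}(t+1)$ denotes the minimal eigenvalue of $P_{t+1}^{-1}$, and $\sigma_t>0$ is given by $\sigma_t^2:=\mathrm{Var}(y_{t+1}\mid\mathcal{F}_t^y)=\sigma^2+\phi_t^\tau P_t\phi_t$, where $\mathcal{F}_t^y=\sigma\{y_i,0\le i\le t\}$. *)

theory Defs
  imports "HOL-Probability.Probability"
begin

definition Ck_on :: "nat \<Rightarrow> (real \<Rightarrow> real) \<Rightarrow> real set \<Rightarrow> bool" where
  "Ck_on k f E \<longleftrightarrow>
     (\<forall>j<k. \<forall>x\<in>E. ((deriv ^^ j) f) field_differentiable (at x)) \<and>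
     (\<forall>j\<le>k. continuous_on E ((deriv ^^ j) f))"

definition lin_indep_on :: "real set \<Rightarrow> (real \<Rightarrow> real ^ 'n) \<Rightarrow> bool" where
  "lin_indep_on E \<phi> \<longleftrightarrow>
     (\<forall>c :: 'n \<Rightarrow> real. (\<forall>x\<in>E. (\<Sum>j\<in>UNIV. c j * \<phi> x $ j) = 0) \<longrightarrow> (\<forall>j. c j = 0))"

definition std_normal_vec_density :: "real ^ 'n \<Rightarrow> real ^ 'n \<Rightarrow> real" where
  "std_normal_vec_density m x =
     exp (- (norm (x - m))\<^sup>2 / 2) / sqrt ((2 * pi) ^ CARD('n))"

definition outer_prod :: "real ^ 'n \<Rightarrow> real ^ 'n \<Rightarrow> real ^ 'n ^ 'n" where
  "outer_prod a b = (\<chi> i j. a $ i * b $ j)"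

definition is_eigenvalue :: "real ^ 'n ^ 'n \<Rightarrow> real \<Rightarrow> bool" where
  "is_eigenvalue A l \<longleftrightarrow> (\<exists>v. v \<noteq> 0 \<and> A *v v = l *\<^sub>R v)"

definition min_eigenvalue :: "real ^ 'n ^ 'n \<Rightarrow> real" where
  "min_eigenvalue A = (LEAST l. is_eigenvalue A l)"

definition gen_sigma :: "'a measure \<Rightarrow> (nat \<Rightarrow> 'a \<Rightarrow> real) \<Rightarrow> nat set \<Rightarrow> 'a measure" where
  "gen_sigma M X I =
     sigma (space M) (\<Union>i\<in>I. {X i -` A \<inter> space M | A. A \<in> sets borel})"

text \<open>The conditional mean and variance are taken through positive and negative parts, so they
  make sense for a variable that is not integrable, e.g. an output of the system below when
  \<open>\<phi>\<close> grows fast.\<close>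

definition cond_var :: "'a measure \<Rightarrow> 'a measure \<Rightarrow> ('a \<Rightarrow> real) \<Rightarrow> 'a \<Rightarrow> ennreal" where
  "cond_var M F X = nn_cond_exp M F (\<lambda>\<omega>. ennreal ((X \<omega> - real_cond_exp M F X \<omega>)\<^sup>2))"

definition cond_sd :: "'a measure \<Rightarrow> (nat \<Rightarrow> 'a \<Rightarrow> real) \<Rightarrow> nat \<Rightarrow> 'a \<Rightarrow> real" where
  "cond_sd M y t \<omega> = sqrt (enn2real (cond_var M (gen_sigma M y {0..t}) (y (Suc t)) \<omega>))"

text \<open>All equations of the closed loop are required to hold pointwise; they determine
  \<open>y\<close>, \<open>u\<close>, \<open>\<theta>h\<close> and \<open>P\<close> on \<open>space M\<close>. The parameter \<open>\<theta>\<close>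
  and the noise \<open>w\<close> are random; of the latter only \<open>w 1, w 2, \<dots>\<close> occur.\<close>

definition closed_loop ::
  "'a measure \<Rightarrow> (real \<Rightarrow> real ^ 'n) \<Rightarrow> real \<Rightarrow> real ^ 'n \<Rightarrow> real \<Rightarrow>
   ('a \<Rightarrow> real ^ 'n) \<Rightarrow> (nat \<Rightarrow> 'a \<Rightarrow> real) \<Rightarrow> (nat \<Rightarrow> 'a \<Rightarrow> real) \<Rightarrow> (nat \<Rightarrow> 'a \<Rightarrow> real) \<Rightarrow>
   (nat \<Rightarrow> 'a \<Rightarrow> real ^ 'n) \<Rightarrow> (nat \<Rightarrow> 'a \<Rightarrow> real ^ 'n ^ 'n) \<Rightarrow> bool" where
  "closed_loop M \<phi> \<sigma> \<theta>0 y0 \<theta> w y u \<theta>h P \<longleftrightarrow>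
     (\<forall>\<omega>\<in>space M.
        y 0 \<omega> = y0 \<and> \<theta>h 0 \<omega> = \<theta>0 \<and> P 0 \<omega> = mat 1 \<and>
        (\<forall>t. let \<phi>t = \<phi> (y t \<omega>) in
           u t \<omega> = - (\<theta>h t \<omega> \<bullet> \<phi>t) \<and>
           y (Suc t) \<omega> = \<theta> \<omega> \<bullet> \<phi>t + u t \<omega> + w (Suc t) \<omega> \<and>
           P (Suc t) \<omega> = P t \<omega> - inverse (\<sigma>\<^sup>2 + \<phi>t \<bullet> (P t \<omega> *v \<phi>t)) *\<^sub>R
              (P t \<omega> ** outer_prod \<phi>t \<phi>t ** P t \<omega>) \<and>
           \<theta>h (Suc t) \<omega> = \<theta>h t \<omega> + (inverse (\<sigma>\<^sup>2) * (y (Suc t) \<omega> - u t \<omega> - \<phi>t \<bullet> \<theta>h t \<omega>)) *\<^sub>R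
              (P (Suc t) \<omega> *v \<phi>t)))"

end

theory Submission
  imports Defs "HOL-Library.Discrete_Functions"
begin

text \<open>
  Given the outputs up to time \<open>t\<close>, the parameter is normal with mean \<open>\<theta>h t\<close> and
  covariance \<open>P t\<close> (Bayes' rule), so the next output is centred normal with variance
  \<open>\<sigma>\<^sup>2 + \<phi> \<bullet> P \<phi>\<close>. Since this variance is at least \<open>\<sigma>\<^sup>2\<close>, the output falls into a fixed
  bounded interval with conditional probability at least a constant over \<open>\<sigma>\<^sub>t\<close>, and by a strong
  law for bounded orthogonal sequences the frequencies of these visits follow the averaged
  conditional probabilities. By linear independence and compactness of the unit sphere there are
  finitely many intervals such that every unit vector \<open>x\<close> has \<open>\<bar>x \<bullet> \<phi>\<bar>\<close> bounded below on one of
  them; hence the visits to the least visited interval bound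
  \<open>x \<bullet> P\<^sup>-\<^sup>1 x = 1 + \<sigma>\<^sup>-\<^sup>2 (\<Sum>i. (x \<bullet> \<phi> (y i))\<^sup>2)\<close> from below.
\<close>

section \<open>Matrices and their least eigenvalue\<close>

text \<open>Two obstacles shape the proof. The unit vector attaining the least eigenvalue varies
  with the path and with time, so no limit theorem can be applied along it; intervals fixed in
  advance reduce the question to finitely many visit frequencies, and the sum of their absolute
  deviations serves all directions at once. Moreover, feedback makes every output depend on the
  whole past, and \<open>\<phi>\<close> may grow so fast that outputs lack a mean; hence Bayes' rule
  is stated as an equality of integrals of nonnegative functions of parameter and history, and the
  strong law is applied to centred indicators, which are bounded by 1 and uncorrelated. Filtering
  survives the feedback because \<open>u t\<close> is a function of the outputs up to time
  \<open>t\<close> and cancels the predicted part \<open>\<theta>h t \<bullet> \<phi> (y t)\<close>: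
  the innovation driving the estimate is the output itself. The final constant is a product:
  \<open>\<delta>\<^sup>2 / \<sigma>\<^sup>2\<close> is the information gained per visit, and the
  other factor bounds \<open>sd\<close> times the probability of a visit from below.\<close>

lemma outer_prod_mult_vec: "outer_prod a b *v x = (b \<bullet> x) *\<^sub>R a"
  by (simp add: vec_eq_iff outer_prod_def matrix_vector_mult_def inner_vec_def sum_distrib_left
      sum_distrib_right mult_ac)

text \<open>If \<open>B *v v\<close> were nonzero, a small move from \<open>v\<close> against it
  would make the quadratic form negative, since the linear term dominates.\<close>

lemma psd_isotropic_in_kernel:
  fixes B :: "real ^ 'n ^ 'n"
  assumes sym: "\<And>x y. x \<bullet> (B *v y) = (B *v x) \<bullet> y"
    and psd: "\<And>x. 0 \<le> x \<bullet> (B *v x)"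
    and v: "v \<bullet> (B *v v) = 0"
  shows "B *v v = 0"
proof (rule ccontr)
  assume ne: "B *v v \<noteq> 0"
  define g where "g = B *v v"
  define q where "q = g \<bullet> (B *v g)"
  have g: "g \<bullet> g > 0" using ne by (simp add: g_def)
  have *: "0 \<le> 2 * s * (g \<bullet> g) + s\<^sup>2 * q" for s
  proof -
    have "0 \<le> (v + s *\<^sub>R g) \<bullet> (B *v (v + s *\<^sub>R g))" by (rule psd)
    also have "\<dots> = v \<bullet> (B *v v) + s * (v \<bullet> (B *v g)) + s * (g \<bullet> (B *v v)) + s\<^sup>2 * q"
      by (simp add: q_def matrix_vector_right_distrib matrix_vector_mult_scaleR inner_add_left
          inner_add_right power2_eq_square algebra_simps)
    also have "v \<bullet> (B *v g) = g \<bullet> g" by (simp add: sym g_def)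
    finally show ?thesis using v by (simp add: g_def)
  qed
  have q: "q \<ge> 0" using psd by (simp add: q_def)
  \<comment> \<open>The denominator \<open>q + 1\<close> instead of the minimizing \<open>q\<close>
    also covers \<open>q = 0\<close>.\<close>
  define s where "s = - (g \<bullet> g) / (q + 1)"
  have "2 * s * (g \<bullet> g) + s\<^sup>2 * q = - (g \<bullet> g)\<^sup>2 * (q + 2) / (q + 1)\<^sup>2"
  proof -
    have "(q + 1) * s = - (g \<bullet> g)" using q by (simp add: s_def)
    then have "(q + 1)\<^sup>2 * (2 * s * (g \<bullet> g) + s\<^sup>2 * q) = - (g \<bullet> g)\<^sup>2 * (q + 2)" by algebra
    then show ?thesis using q by (simp add: field_simps)
  qed
  moreover have "\<dots> < 0" using q g by (intro divide_neg_pos mult_neg_pos) auto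
  ultimately show False using *[of s] by linarith
qed

text \<open>The \<open>LEAST\<close> in \<open>min_eigenvalue\<close> says something only once a
  least eigenvalue exists. It is the minimum \<open>l\<close> of the quadratic form on the compact
  unit sphere: \<open>A - l\<close> is positive semidefinite and isotropic at the minimizer, which
  therefore is an eigenvector.\<close>

lemma min_eigenvalue_ge:
  fixes A :: "real ^ 'n ^ 'n"
  assumes sym: "\<And>x y. x \<bullet> (A *v y) = (A *v x) \<bullet> y"
    and ge: "\<And>x. norm x = 1 \<Longrightarrow> c \<le> x \<bullet> (A *v x)"
  shows "c \<le> min_eigenvalue A"
proof -
  have "compact (sphere (0::real^'n) 1)" "sphere (0::real^'n) 1 \<noteq> {}" by auto
  moreover have "continuous_on (sphere 0 1) (\<lambda>x. x \<bullet> (A *v x))"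
    by (intro continuous_on_inner continuous_on_id matrix_vector_mult_linear_continuous_on)
  ultimately obtain v where v: "norm v = 1"
    and min: "\<And>x. norm x = 1 \<Longrightarrow> v \<bullet> (A *v v) \<le> x \<bullet> (A *v x)"
    using continuous_attains_inf[of "sphere 0 1" "\<lambda>x. x \<bullet> (A *v x)"] by (auto simp: dist_norm)
  define l where "l = v \<bullet> (A *v v)"
  have lower: "l * (x \<bullet> x) \<le> x \<bullet> (A *v x)" for x
  proof (cases "x = 0")
    case False
    have "l \<le> (x /\<^sub>R norm x) \<bullet> (A *v (x /\<^sub>R norm x))"
      unfolding l_def using False by (intro min) simp
    also have "\<dots> = (x \<bullet> (A *v x)) / (norm x)\<^sup>2"
      by (simp add: matrix_vector_mult_scaleR power2_eq_square divide_inverse)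
    finally have "l * (norm x)\<^sup>2 \<le> x \<bullet> (A *v x)" using False by (simp add: pos_le_divide_eq)
    then show ?thesis by (simp add: power2_norm_eq_inner)
  qed simp
  define B where "B = A - l *\<^sub>R mat 1"
  have Bx: "B *v x = A *v x - l *\<^sub>R x" for x
    by (simp add: B_def matrix_vector_mult_diff_rdistrib scaleR_matrix_vector_assoc[symmetric])
  have "B *v v = 0"
  proof (rule psd_isotropic_in_kernel)
    show "x \<bullet> (B *v y) = (B *v x) \<bullet> y" for x y
      by (simp add: Bx inner_diff_left inner_diff_right sym)
    show "0 \<le> x \<bullet> (B *v x)" for x using lower[of x] by (simp add: Bx inner_diff_right)
    show "v \<bullet> (B *v v) = 0"
      using v by (simp add: Bx inner_diff_right l_def dot_square_norm)
  qed
  then have ev: "is_eigenvalue A l"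
    using v by (auto simp: is_eigenvalue_def Bx intro!: exI[of _ v])
  have "l \<le> k" if k: "is_eigenvalue A k" for k
  proof -
    obtain x where x: "x \<noteq> 0" "A *v x = k *\<^sub>R x" using k by (auto simp: is_eigenvalue_def)
    then have "l * (x \<bullet> x) \<le> k * (x \<bullet> x)" using lower[of x] by simp
    then show ?thesis using x(1) by simp
  qed
  then have "min_eigenvalue A = l"
    unfolding min_eigenvalue_def using ev by (intro Least_equality) auto
  then show ?thesis using ge[OF v] by (simp add: l_def)
qed

section \<open>Measurability of matrix operations\<close>

lemma borel_measurable_matrix_vector_mult [measurable (raw)]:
  fixes A :: "'a \<Rightarrow> real ^ 'n ^ 'm" and v :: "'a \<Rightarrow> real ^ 'n"
  assumes [measurable]: "A \<in> borel_measurable M" "v \<in> borel_measurable M"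
  shows "(\<lambda>x. A x *v v x) \<in> borel_measurable M"
proof (rule borel_measurable_continuous_Pair[OF assms])
  show "continuous_on UNIV (\<lambda>x :: (real ^ 'n ^ 'm) \<times> (real ^ 'n). fst x *v snd x)"
    by (simp add: matrix_vector_mult_def) (intro continuous_intros)
qed

lemma borel_measurable_matrix_mult [measurable (raw)]:
  fixes A :: "'a \<Rightarrow> real ^ 'n ^ 'm" and B :: "'a \<Rightarrow> real ^ 'k ^ 'n"
  assumes [measurable]: "A \<in> borel_measurable M" "B \<in> borel_measurable M"
  shows "(\<lambda>x. A x ** B x) \<in> borel_measurable M"
proof (rule borel_measurable_continuous_Pair[OF assms])
  show "continuous_on UNIV (\<lambda>x :: (real ^ 'n ^ 'm) \<times> (real ^ 'k ^ 'n). fst x ** snd x)"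
    by (simp add: matrix_matrix_mult_def) (intro continuous_intros)
qed

lemma borel_measurable_outer_prod [measurable (raw)]:
  fixes a b :: "'a \<Rightarrow> real ^ 'n"
  assumes [measurable]: "a \<in> borel_measurable M" "b \<in> borel_measurable M"
  shows "(\<lambda>x. outer_prod (a x) (b x)) \<in> borel_measurable M"
proof (rule borel_measurable_continuous_Pair[OF assms])
  show "continuous_on UNIV (\<lambda>x :: (real ^ 'n) \<times> (real ^ 'n). outer_prod (fst x) (snd x))"
    by (simp add: outer_prod_def) (intro continuous_intros)
qed

section \<open>Directional excitation\<close>

text \<open>Linear independence gives each unit vector \<open>x\<close> a point \<open>s\<close> of
  \<open>E\<close> with \<open>x \<bullet> \<phi> s\<close> nonzero. As \<open>E\<close> is open,
  \<open>\<phi>\<close> is continuous at \<open>s\<close> on the whole line, so joint continuity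
  spreads the bound to a ball around \<open>x\<close> and a full interval around \<open>s\<close>;
  finitely many such balls cover the sphere.\<close>

lemma excitation:
  fixes \<phi> :: "real \<Rightarrow> real ^ 'n"
  assumes E: "open E" and cont: "continuous_on E \<phi>" and li: "lin_indep_on E \<phi>"
  obtains T r \<delta> where "finite T" "r > 0" "\<delta> > 0"
    "\<And>x. norm x = 1 \<Longrightarrow> \<exists>s\<in>T. \<forall>z. \<bar>z - s\<bar> < r \<longrightarrow> \<delta> \<le> \<bar>x \<bullet> \<phi> z\<bar>"
proof -
  define good where "good x s r d e \<longleftrightarrow> r > 0 \<and> d > 0 \<and> e > 0 \<and>
      (\<forall>x'\<in>ball x e. \<forall>z. \<bar>z - s\<bar> < r \<longrightarrow> d \<le> \<bar>x' \<bullet> \<phi> z\<bar>)" for x s r d and e :: real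
  have "\<exists>s r d e. good x s r d e"
    if x: "x \<in> sphere 0 1" for x :: "real ^ 'n"
  proof -
    have "\<exists>s\<in>E. x \<bullet> \<phi> s \<noteq> 0"
    proof (rule ccontr)
      assume "\<not> ?thesis"
      then have "\<forall>s\<in>E. (\<Sum>j\<in>UNIV. x $ j * \<phi> s $ j) = 0" by (simp add: inner_vec_def)
      then have "x = 0" using li unfolding lin_indep_on_def vec_eq_iff by simp
      then show False using x by simp
    qed
    then obtain s where s: "s \<in> E" "x \<bullet> \<phi> s \<noteq> 0" by blast
    have "isCont \<phi> s" using E cont s by (simp add: continuous_on_eq_continuous_at)
    then have "isCont (\<lambda>p. \<phi> (snd p)) (x, s)"
      by (intro isCont_o2[where f=snd and g=\<phi>] continuous_snd continuous_ident) simp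
    then have "isCont (\<lambda>p. fst p \<bullet> \<phi> (snd p)) (x, s)"
      by (intro continuous_inner continuous_fst continuous_ident)
    then have "\<forall>e>0. \<exists>d>0. \<forall>p. dist p (x, s) < d \<longrightarrow>
        dist (fst p \<bullet> \<phi> (snd p)) (x \<bullet> \<phi> s) < e"
      by (simp add: continuous_at_eps_delta)
    moreover have pos: "\<bar>x \<bullet> \<phi> s\<bar> / 2 > 0" using s by simp
    ultimately obtain d where d: "d > 0" "\<And>p. dist p (x, s) < d \<Longrightarrow>
        dist (fst p \<bullet> \<phi> (snd p)) (x \<bullet> \<phi> s) < \<bar>x \<bullet> \<phi> s\<bar> / 2" by blast
    have "\<bar>x \<bullet> \<phi> s\<bar> / 2 \<le> \<bar>x' \<bullet> \<phi> z\<bar>" if "x' \<in> ball x (d / 2)" "\<bar>z - s\<bar> < d / 2" for x' z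
    proof -
      have "dist (x', z) (x, s) \<le> dist x' x + dist z s"
        unfolding dist_Pair_Pair by (rule sqrt_sum_squares_le_sum) simp_all
      also have "\<dots> < d" using that(1)[unfolded mem_ball dist_commute[of x]] that(2)[folded dist_real_def] by simp
      finally have "\<bar>x' \<bullet> \<phi> z - x \<bullet> \<phi> s\<bar> < \<bar>x \<bullet> \<phi> s\<bar> / 2"
        using d(2)[of "(x', z)"] by (simp add: dist_real_def)
      then show ?thesis by linarith
    qed
    then have "good x s (d / 2) (\<bar>x \<bullet> \<phi> s\<bar> / 2) (d / 2)" using d(1) pos by (simp add: good_def)
    then show ?thesis by blast
  qed
  then have "\<exists>s. \<forall>x\<in>sphere 0 1. \<exists>r d e. good x (s x) r d e" by (intro bchoice) blast
  then obtain s where "\<forall>x\<in>sphere 0 1. \<exists>r d e. good x (s x) r d e" by blast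
  then obtain r where "\<forall>x\<in>sphere 0 1. \<exists>d e. good x (s x) (r x) d e" using bchoice by metis
  then obtain d where "\<forall>x\<in>sphere 0 1. \<exists>e. good x (s x) (r x) (d x) e" using bchoice by metis
  then obtain e where sr: "\<forall>x\<in>sphere 0 1. good x (s x) (r x) (d x) (e x)" using bchoice by metis
  have "x \<in> ball x (e x)" if "x \<in> sphere 0 1" for x
    using sr that by (simp add: good_def)
  then have cover: "sphere 0 1 \<subseteq> (\<Union>x\<in>sphere 0 1. ball x (e x))" by blast
  obtain D where D: "D \<subseteq> sphere 0 1" "finite D" "sphere 0 1 \<subseteq> (\<Union>x\<in>D. ball x (e x))"
    using compactE_image[OF compact_sphere _ cover] open_ball by metis
  have pos: "x \<in> D \<Longrightarrow> r x > 0 \<and> d x > 0" for x using sr D(1) by (auto simp: good_def)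
  show thesis
  proof
    show "finite (s ` D)" using D by simp
    \<comment> \<open>Inserting 1 makes the minima meaningful without showing that \<open>D\<close>
      is nonempty.\<close>
    show "Min (insert 1 (r ` D)) > 0" "Min (insert 1 (d ` D)) > 0" using D pos by auto
    fix x :: "real ^ 'n" assume "norm x = 1"
    then have "x \<in> (\<Union>x\<in>D. ball x (e x))" using D(3) by (auto simp del: mem_ball)
    then obtain x0 where x0: "x0 \<in> D" "x \<in> ball x0 (e x0)" by blast
    have m: "Min (insert 1 (r ` D)) \<le> r x0" "Min (insert 1 (d ` D)) \<le> d x0" using D x0 by auto
    have "\<forall>z. \<bar>z - s x0\<bar> < Min (insert 1 (r ` D)) \<longrightarrow> Min (insert 1 (d ` D)) \<le> \<bar>x \<bullet> \<phi> z\<bar>"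
    proof (intro allI impI)
      fix z assume "\<bar>z - s x0\<bar> < Min (insert 1 (r ` D))"
      then have "\<bar>z - s x0\<bar> < r x0" using m(1) by linarith
      moreover have "good x0 (s x0) (r x0) (d x0) (e x0)" using sr x0(1) D(1) by blast
      ultimately have "d x0 \<le> \<bar>x \<bullet> \<phi> z\<bar>" using x0(2) by (simp add: good_def)
      then show "Min (insert 1 (d ` D)) \<le> \<bar>x \<bullet> \<phi> z\<bar>" using m(2) by linarith
    qed
    then show "\<exists>s\<in>s ` D. \<forall>z. \<bar>z - s\<bar> < Min (insert 1 (r ` D)) \<longrightarrow> Min (insert 1 (d ` D)) \<le> \<bar>x \<bullet> \<phi> z\<bar>"
      using x0 by blast
  qed
qed

section \<open>A strong law for bounded orthogonal sequences\<close>

lemma filterlim_floor_sqrt: "filterlim floor_sqrt sequentially sequentially"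
  unfolding filterlim_at_top
proof
  fix Z
  show "\<forall>\<^sub>F n in sequentially. Z \<le> floor_sqrt n"
    using eventually_ge_at_top[of "Z\<^sup>2"] by eventually_elim (rule le_floor_sqrtI)
qed

text \<open>Between consecutive squares, from \<open>k\<^sup>2\<close> on, \<open>s\<close> changes
  by at most \<open>2 * k\<close>, which is negligible against \<open>k\<^sup>2\<close>.\<close>

lemma tendsto_average_from_squares:
  fixes s :: "nat \<Rightarrow> real"
  assumes step: "\<And>n. \<bar>s (Suc n) - s n\<bar> \<le> 1"
    and sq: "(\<lambda>k. s (k\<^sup>2) / real (k\<^sup>2)) \<longlonglongrightarrow> 0"
  shows "(\<lambda>n. s n / real n) \<longlonglongrightarrow> 0"
proof -
  have steps: "\<bar>s (n + m) - s n\<bar> \<le> real m" for n m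
  proof (induction m)
    case (Suc m)
    then show ?case using step[of "n + m"] by simp
  qed simp
  let ?k = floor_sqrt
  have "(\<lambda>n. \<bar>s ((?k n)\<^sup>2) / real ((?k n)\<^sup>2)\<bar> + 2 / real (?k n)) \<longlonglongrightarrow> 0"
  proof -
    have "(\<lambda>k. \<bar>s (k\<^sup>2) / real (k\<^sup>2)\<bar> + 2 / real k) \<longlonglongrightarrow> \<bar>0\<bar> + 0"
      by (intro tendsto_add tendsto_rabs sq lim_const_over_n)
    from filterlim_compose[OF this filterlim_floor_sqrt] show ?thesis by simp
  qed
  moreover have "\<bar>s n / real n\<bar> \<le> \<bar>s ((?k n)\<^sup>2) / real ((?k n)\<^sup>2)\<bar> + 2 / real (?k n)" for n
  proof (cases "n = 0")
    case False
    define k where "k = ?k n"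
    have k: "k > 0" "k\<^sup>2 \<le> n" using False by (simp_all add: k_def)
    have "n < (Suc k)\<^sup>2" unfolding k_def by (rule Suc_floor_sqrt_power2_gt)
    then have n: "n - k\<^sup>2 \<le> 2 * k" by (simp add: power2_eq_square)
    have "\<bar>s n\<bar> \<le> \<bar>s (k\<^sup>2)\<bar> + real (n - k\<^sup>2)" using steps[of "k\<^sup>2" "n - k\<^sup>2"] k by simp
    also have "\<dots> \<le> \<bar>s (k\<^sup>2)\<bar> + 2 * real k" using n by linarith
    finally have "\<bar>s n\<bar> / real n \<le> (\<bar>s (k\<^sup>2)\<bar> + 2 * real k) / real n"
      by (rule divide_right_mono) simp
    also have "\<dots> \<le> (\<bar>s (k\<^sup>2)\<bar> + 2 * real k) / real (k\<^sup>2)"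
    proof (rule divide_left_mono)
      show "real (k\<^sup>2) \<le> real n" using k(2) by (simp only: of_nat_le_iff)
      show "0 < real n * real (k\<^sup>2)" using False k by simp
    qed simp
    also have "\<dots> = \<bar>s (k\<^sup>2) / real (k\<^sup>2)\<bar> + 2 / real k"
      using k by (simp add: add_divide_distrib power2_eq_square)
    finally show ?thesis by (simp add: k_def)
  qed simp
  ultimately have "(\<lambda>n. \<bar>s n / real n\<bar>) \<longlonglongrightarrow> 0"
    by (intro tendsto_sandwich[where f="\<lambda>_. 0" and g="\<lambda>n. \<bar>s n / real n\<bar>"]) (auto simp del: abs_divide)
  then show ?thesis by (rule tendsto_rabs_zero_cancel)
qed

text \<open>The second moments of the averages at square times are summable, which gives convergence along
  the squares; boundedness fills the gaps.\<close>

lemma (in prob_space) orthogonal_strong_law: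
  fixes D :: "nat \<Rightarrow> 'a \<Rightarrow> real"
  assumes [measurable]: "\<And>i. D i \<in> borel_measurable M"
    and bound: "\<And>i \<omega>. \<omega> \<in> space M \<Longrightarrow> \<bar>D i \<omega>\<bar> \<le> 1"
    and orth: "\<And>i j. i < j \<Longrightarrow> expectation (\<lambda>\<omega>. D i \<omega> * D j \<omega>) = 0"
  shows "AE \<omega> in M. (\<lambda>t. (\<Sum>i<t. D i \<omega>) / real t) \<longlonglongrightarrow> 0"
proof -
  define S where "S t \<omega> = (\<Sum>i<t. D i \<omega>)" for t \<omega>
  have [measurable]: "S t \<in> borel_measurable M" for t unfolding S_def by measurable
  have iD: "integrable M (\<lambda>\<omega>. D i \<omega> * D j \<omega>)" for i j
    by (rule integrable_const_bound[where B=1])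
      (auto intro!: AE_I2 mult_le_one simp: abs_mult bound)
  have Sq: "(S t \<omega>)\<^sup>2 = (\<Sum>i<t. \<Sum>j<t. D i \<omega> * D j \<omega>)" for t \<omega>
    by (simp add: S_def power2_eq_square sum_product)
  have iS: "integrable M (\<lambda>\<omega>. (S t \<omega>)\<^sup>2)" for t
    unfolding Sq by (intro Bochner_Integration.integrable_sum iD)
  have ES: "expectation (\<lambda>\<omega>. (S t \<omega>)\<^sup>2) \<le> real t" for t
  proof -
    have "expectation (\<lambda>\<omega>. (S t \<omega>)\<^sup>2) = (\<Sum>i<t. \<Sum>j<t. expectation (\<lambda>\<omega>. D i \<omega> * D j \<omega>))"
      unfolding Sq by (subst Bochner_Integration.integral_sum, intro Bochner_Integration.integrable_sum iD)
        (intro sum.cong refl Bochner_Integration.integral_sum iD)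
    \<comment> \<open>Orthogonality removes the off-diagonal terms and the bound 1 controls the
      diagonal, so the second moment grows only linearly.\<close>
    also have "\<dots> \<le> (\<Sum>i<t. \<Sum>j<t. if j = i then 1 else 0)"
    proof (intro sum_mono)
      fix i j
      show "expectation (\<lambda>\<omega>. D i \<omega> * D j \<omega>) \<le> (if j = i then 1 else 0)"
      proof (cases i j rule: linorder_cases)
        case equal
        have "expectation (\<lambda>\<omega>. D i \<omega> * D j \<omega>) \<le> expectation (\<lambda>_. 1)"
        proof (rule integral_mono[OF iD])
          fix \<omega> assume "\<omega> \<in> space M"
          then have "\<bar>D i \<omega>\<bar> * \<bar>D j \<omega>\<bar> \<le> 1" by (intro mult_le_one bound) auto
          then show "D i \<omega> * D j \<omega> \<le> 1" by (metis abs_le_D1 abs_mult)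
        qed simp
        then show ?thesis using equal prob_space by simp
      next
        case greater
        then show ?thesis using orth[of j i] by (simp add: mult.commute)
      qed (simp add: orth)
    qed
    also have "\<dots> = real t" by simp
    finally show ?thesis .
  qed
  define f where "f k \<omega> = (S (k\<^sup>2) \<omega> / real (k\<^sup>2))\<^sup>2" for k \<omega>
  have [measurable]: "f k \<in> borel_measurable M" for k unfolding f_def by measurable
  have "(\<integral>\<^sup>+ \<omega>. f k \<omega> \<partial>M) \<le> ennreal (inverse ((real k)\<^sup>2))" for k
  proof -
    have fk: "f k = (\<lambda>\<omega>. (S (k\<^sup>2) \<omega>)\<^sup>2 / (real (k\<^sup>2))\<^sup>2)" by (simp add: f_def power_divide fun_eq_iff)
    have "(\<integral>\<^sup>+ \<omega>. f k \<omega> \<partial>M) = ennreal (expectation (f k))"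
      unfolding fk by (intro nn_integral_eq_integral integrable_divide iS) auto
    also have "expectation (f k) \<le> real (k\<^sup>2) / (real (k\<^sup>2))\<^sup>2"
      unfolding fk integral_divide_zero by (intro divide_right_mono ES) simp
    \<comment> \<open>At \<open>k = 0\<close> both sides are 0, because division by zero yields
      0.\<close>
    also have "\<dots> = inverse ((real k)\<^sup>2)" by (cases "k = 0") (simp_all add: power2_eq_square field_simps)
    finally show ?thesis by (simp add: ennreal_leI)
  qed
  then have "(\<Sum>k. \<integral>\<^sup>+ \<omega>. f k \<omega> \<partial>M) \<le> (\<Sum>k. ennreal (inverse ((real k)\<^sup>2)))"
    by (intro suminf_le) auto
  also have "\<dots> < \<infinity>"
  proof -
    have "summable (\<lambda>k. inverse ((real k)\<^sup>2))" by (rule inverse_power_summable) simp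
    then show ?thesis by (simp add: suminf_ennreal_eq[OF _ summable_sums])
  qed
  finally have "(\<integral>\<^sup>+ \<omega>. (\<Sum>k. ennreal (f k \<omega>)) \<partial>M) \<noteq> \<infinity>" by (subst nn_integral_suminf) auto
  then have "AE \<omega> in M. (\<Sum>k. ennreal (f k \<omega>)) \<noteq> \<infinity>" by (intro nn_integral_PInf_AE) auto
  then show ?thesis
  proof (rule AE_mp, intro AE_I2 impI)
    fix \<omega> assume \<omega>: "\<omega> \<in> space M" and "(\<Sum>k. ennreal (f k \<omega>)) \<noteq> \<infinity>"
    then have "summable (\<lambda>k. f k \<omega>)" by (intro summable_suminf_not_top) (auto simp: f_def)
    then have "(\<lambda>k. sqrt (f k \<omega>)) \<longlonglongrightarrow> sqrt 0" by (intro tendsto_real_sqrt summable_LIMSEQ_zero)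
    then have "(\<lambda>k. S (k\<^sup>2) \<omega> / real (k\<^sup>2)) \<longlonglongrightarrow> 0"
      by (intro tendsto_rabs_zero_cancel[of "\<lambda>k. S (k\<^sup>2) \<omega> / real (k\<^sup>2)"]) (simp add: f_def)
    then have "(\<lambda>n. S n \<omega> / real n) \<longlonglongrightarrow> 0"
      by (intro tendsto_average_from_squares) (simp_all add: S_def bound[OF \<omega>])
    then show "(\<lambda>t. (\<Sum>i<t. D i \<omega>) / real t) \<longlonglongrightarrow> 0" by (simp add: S_def)
  qed
qed

section \<open>The Gaussian filter\<close>

lemma nn_integral_lborel_translate:
  fixes f :: "'b::euclidean_space \<Rightarrow> ennreal"
  assumes [measurable]: "f \<in> borel_measurable borel"
  shows "(\<integral>\<^sup>+ x. f (c + x) \<partial>lborel) = (\<integral>\<^sup>+ x. f x \<partial>lborel)"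
  using nn_integral_distr[of "(+) c" lborel borel f] lborel_distr_plus[of c] by simp

lemma normal_density_integral:
  assumes "s > 0"
  shows "(\<integral>\<^sup>+ x. normal_density m s x \<partial>lborel) = 1"
  using assms by (simp add: nn_integral_eq_integral)

locale regulator =
  fixes \<phi> :: "real \<Rightarrow> real ^ 'n" and \<sigma> :: real and \<theta>0 :: "real ^ 'n"
  assumes sigma_pos: "\<sigma> > 0"
    and phi_measurable [measurable]: "\<phi> \<in> borel_measurable borel"
begin

text \<open>The filter is written for an arbitrary deterministic path \<open>H\<close>, since it
  depends on chance only through the outputs; Bayes' rule then becomes an identity for fixed
  \<open>H\<close>.\<close>

primrec cov :: "nat \<Rightarrow> (nat \<Rightarrow> real) \<Rightarrow> real ^ 'n ^ 'n" where
  "cov 0 H = mat 1"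
| "cov (Suc t) H = cov t H - inverse (\<sigma>\<^sup>2 + \<phi> (H t) \<bullet> (cov t H *v \<phi> (H t))) *\<^sub>R
     (cov t H ** outer_prod (\<phi> (H t)) (\<phi> (H t)) ** cov t H)"

text \<open>The innovation is just \<open>H (Suc t)\<close>: under the control law the terms
  \<open>u t\<close> and \<open>\<phi> \<bullet> \<theta>h t\<close> cancel.\<close>

primrec est :: "nat \<Rightarrow> (nat \<Rightarrow> real) \<Rightarrow> real ^ 'n" where
  "est 0 H = \<theta>0"
| "est (Suc t) H = est t H + (inverse (\<sigma>\<^sup>2) * H (Suc t)) *\<^sub>R (cov (Suc t) H *v \<phi> (H t))"

text \<open>The inverse of \<open>cov t H\<close>, given its own recursion so that its quadratic
  form is visibly a sum of squares.\<close>

primrec prec :: "nat \<Rightarrow> (nat \<Rightarrow> real) \<Rightarrow> real ^ 'n ^ 'n" where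
  "prec 0 H = mat 1"
| "prec (Suc t) H = prec t H + inverse (\<sigma>\<^sup>2) *\<^sub>R outer_prod (\<phi> (H t)) (\<phi> (H t))"

text \<open>The predictive variance \<open>\<sigma>\<^sub>t\<^sup>2\<close>: noise plus remaining
  parameter uncertainty in the direction of the regressor.\<close>

definition pvar :: "nat \<Rightarrow> (nat \<Rightarrow> real) \<Rightarrow> real" where
  "pvar t H = \<sigma>\<^sup>2 + \<phi> (H t) \<bullet> (cov t H *v \<phi> (H t))"

text \<open>The factor \<open>sqrt (pvar t H) / \<sigma>\<close> is the square root of
  \<open>det (cov t H) / det (cov (Suc t) H)\<close>.\<close>

primrec normalizer :: "nat \<Rightarrow> (nat \<Rightarrow> real) \<Rightarrow> real" where
  "normalizer 0 H = 1 / sqrt ((2 * pi) ^ CARD('n))"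
| "normalizer (Suc t) H = normalizer t H * (sqrt (pvar t H) / \<sigma>)"

text \<open>The normal density with mean \<open>est t H\<close> and covariance
  \<open>cov t H\<close>, its constant built up as a product along the path. That it has total mass
  1 is proved in \<open>posterior_integral\<close>.\<close>

definition posterior :: "nat \<Rightarrow> (nat \<Rightarrow> real) \<Rightarrow> real ^ 'n \<Rightarrow> real" where
  "posterior t H z =
     normalizer t H * exp (- ((z - est t H) \<bullet> (prec t H *v (z - est t H))) / 2)"

section \<open>Rank-one updates of precision and covariance\<close>

lemma prec_mult_vec_Suc:
  "prec (Suc t) H *v x = prec t H *v x + (\<phi> (H t) \<bullet> x / \<sigma>\<^sup>2) *\<^sub>R \<phi> (H t)"
  by (simp add: matrix_vector_mult_add_rdistrib scaleR_matrix_vector_assoc[symmetric]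
      outer_prod_mult_vec divide_inverse mult_ac)

lemma cov_mult_vec_Suc:
  "cov (Suc t) H *v x =
     cov t H *v x - (\<phi> (H t) \<bullet> (cov t H *v x) / pvar t H) *\<^sub>R (cov t H *v \<phi> (H t))"
  by (simp add: matrix_vector_mult_diff_rdistrib scaleR_matrix_vector_assoc[symmetric] pvar_def
      matrix_vector_mul_assoc[symmetric] outer_prod_mult_vec divide_inverse matrix_vector_mult_scaleR
      mult_ac)

lemma prec_sym: "x \<bullet> (prec t H *v y) = (prec t H *v x) \<bullet> y"
  by (induction t) (simp_all add: prec_mult_vec_Suc inner_add_left inner_add_right inner_commute
      del: prec.simps(2))

text \<open>Used twice: for the positivity of the covariance, and at the end to turn visits into a
  bound on the least eigenvalue.\<close>

lemma prec_quadratic: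
  "x \<bullet> (prec t H *v x) = x \<bullet> x + (\<Sum>i<t. (x \<bullet> \<phi> (H i))\<^sup>2) / \<sigma>\<^sup>2"
  by (induction t) (simp_all add: prec_mult_vec_Suc inner_add_right inner_commute add_divide_distrib
      power2_eq_square del: prec.simps(2))

text \<open>The claims need a joint induction. The Sherman-Morrison computation divides by
  \<open>pvar\<close>, whose positivity rests on that of \<open>cov\<close> at the same time;
  positivity of the next \<open>cov\<close> is read off its inverse, with \<open>y = cov x\<close>
  giving \<open>x \<bullet> y = y \<bullet> prec y\<close>.\<close>

lemma cov_facts:
  shows prec_cov_vec: "prec t H *v (cov t H *v x) = x"
    and cov_prec_vec: "cov t H *v (prec t H *v x) = x"
    and cov_sym: "x \<bullet> (cov t H *v y) = (cov t H *v x) \<bullet> y"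
    and cov_nonneg: "0 \<le> x \<bullet> (cov t H *v x)"
    and pvar_ge: "\<sigma>\<^sup>2 \<le> pvar t H"
proof (atomize (full), induction t arbitrary: x y)
  case 0
  show ?case by (simp add: pvar_def)
next
  case (Suc t)
  note pc = Suc[THEN conjunct1, THEN conjunct1] and cp = Suc[THEN conjunct1, THEN conjunct2]
    and sy = Suc[THEN conjunct2, THEN conjunct1]
  have pv: "pvar t H \<ge> \<sigma>\<^sup>2" using Suc by blast
  then have pos: "pvar t H > 0" "\<sigma>\<^sup>2 > 0" using sigma_pos by (auto intro: less_le_trans[rotated])
  let ?f = "\<phi> (H t)" let ?p = "cov t H *v ?f" let ?s = "?f \<bullet> ?p"
  have s: "?s = pvar t H - \<sigma>\<^sup>2" by (simp add: pvar_def)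
  have 1: "prec (Suc t) H *v (cov (Suc t) H *v x) = x" for x
  proof -
    let ?a = "?f \<bullet> (cov t H *v x)"
    have "prec (Suc t) H *v (cov (Suc t) H *v x) =
      x - (?a / pvar t H) *\<^sub>R ?f + ((?a - ?a / pvar t H * ?s) / \<sigma>\<^sup>2) *\<^sub>R ?f"
      unfolding prec_mult_vec_Suc cov_mult_vec_Suc
      by (simp add: matrix_vector_mult_diff_distrib matrix_vector_mult_scaleR pc inner_diff_right)
    also have "(?a - ?a / pvar t H * ?s) / \<sigma>\<^sup>2 = ?a / pvar t H"
      using pos by (simp add: s field_simps)
    finally show ?thesis by simp
  qed
  have 2: "cov (Suc t) H *v (prec (Suc t) H *v x) = x" for x
  proof -
    let ?b = "?f \<bullet> x"
    have "cov (Suc t) H *v (prec (Suc t) H *v x) =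
      x + (?b / \<sigma>\<^sup>2) *\<^sub>R ?p - ((?b + ?b / \<sigma>\<^sup>2 * ?s) / pvar t H) *\<^sub>R ?p"
      unfolding prec_mult_vec_Suc cov_mult_vec_Suc
      by (simp add: matrix_vector_right_distrib matrix_vector_mult_scaleR cp inner_add_right)
    also have "(?b + ?b / \<sigma>\<^sup>2 * ?s) / pvar t H = ?b / \<sigma>\<^sup>2"
      using pos by (simp add: s field_simps)
    finally show ?thesis by simp
  qed
  have 3: "x \<bullet> (cov (Suc t) H *v y) = (cov (Suc t) H *v x) \<bullet> y" for x y
    unfolding cov_mult_vec_Suc using sy[of x y] sy[of x ?f] sy[of ?f y] sy[of ?f x]
    by (simp add: inner_diff_left inner_diff_right inner_commute)
  have 4: "0 \<le> x \<bullet> (cov (Suc t) H *v x)" for x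
  proof -
    let ?y = "cov (Suc t) H *v x"
    have "x \<bullet> ?y = ?y \<bullet> (prec (Suc t) H *v ?y)" by (simp only: 1 inner_commute)
    also have "\<dots> \<ge> 0" unfolding prec_quadratic by (intro add_nonneg_nonneg divide_nonneg_nonneg sum_nonneg) auto
    finally show ?thesis .
  qed
  have 5: "\<sigma>\<^sup>2 \<le> pvar (Suc t) H" using 4[of "\<phi> (H (Suc t))"] unfolding pvar_def by linarith
  show ?case using 1 2 3 4 5 by blast
qed

lemma pvar_pos: "pvar t H > 0"
  using pvar_ge[of t H] sigma_pos by (auto intro: less_le_trans[rotated])

text \<open>\<open>matrix_inv\<close> is a choice operator; uniqueness of two-sided inverses pins it
  down.\<close>

lemma matrix_inv_cov: "matrix_inv (cov t H) = prec t H"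
proof -
  have "cov t H ** prec t H = mat 1" "prec t H ** cov t H = mat 1"
    by (simp_all add: matrix_eq matrix_vector_mul_assoc[symmetric] cov_prec_vec prec_cov_vec)
  then show ?thesis
    unfolding matrix_inv_def
    by (intro some_equality) (auto, metis matrix_mul_assoc matrix_mul_lid matrix_mul_rid)
qed

text \<open>Causality: at time \<open>t\<close> nothing later than \<open>H t\<close> is read. This
  permits passing between full paths and truncated histories and overwriting the output at
  \<open>Suc t\<close>.\<close>

lemma cong_history:
  assumes "\<And>s. s \<le> t \<Longrightarrow> H s = H' s"
  shows cov_cong: "cov t H = cov t H'" and prec_cong: "prec t H = prec t H'"
    and est_cong: "est t H = est t H'" and pvar_cong: "pvar t H = pvar t H'"
    and normalizer_cong: "normalizer t H = normalizer t H'"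
proof -
  have 1: "cov s H = cov s H'" if "s \<le> t" for s using that assms by (induction s) auto
  then show "cov t H = cov t H'" by blast
  have 2: "pvar s H = pvar s H'" if "s \<le> t" for s using that assms 1 by (simp add: pvar_def)
  then show "pvar t H = pvar t H'" by blast
  have "prec s H = prec s H'" if "s \<le> t" for s using that assms by (induction s) auto
  then show "prec t H = prec t H'" by blast
  have "est s H = est s H'" if "s \<le> t" for s using that assms
  proof (induction s)
    case (Suc s) then show ?case using 1[of "Suc s"] by (simp del: cov.simps)
  qed simp
  then show "est t H = est t H'" by blast
  have "normalizer s H = normalizer s H'" if "s \<le> t" for s using that 2 by (induction s) auto
  then show "normalizer t H = normalizer t H'" by blast
qed

text \<open>Completing the square in \<open>v\<close>. The vector \<open>a\<close> minimizes the
  left side and is the shift of the estimate caused by output \<open>y\<close>; what remains is the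
  exponent of the predictive density of \<open>y\<close>.\<close>

lemma posterior_update:
  fixes v :: "real ^ 'n" and y :: real and t :: nat and H :: "nat \<Rightarrow> real"
  defines "a \<equiv> (y / \<sigma>\<^sup>2) *\<^sub>R (cov (Suc t) H *v \<phi> (H t))"
  shows "v \<bullet> (prec t H *v v) + (y - v \<bullet> \<phi> (H t))\<^sup>2 / \<sigma>\<^sup>2 =
    y\<^sup>2 / pvar t H + (v - a) \<bullet> (prec (Suc t) H *v (v - a))"
proof -
  let ?f = "\<phi> (H t)"
  have pos: "pvar t H > 0" "\<sigma>\<^sup>2 > 0" using sigma_pos pvar_pos by auto
  have pa: "prec (Suc t) H *v a = (y / \<sigma>\<^sup>2) *\<^sub>R ?f"
    by (simp add: a_def matrix_vector_mult_scaleR prec_cov_vec del: prec.simps cov.simps)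
  have s: "?f \<bullet> (cov t H *v ?f) = pvar t H - \<sigma>\<^sup>2" by (simp add: pvar_def)
  have af: "a \<bullet> ?f = y * (pvar t H - \<sigma>\<^sup>2) / pvar t H"
  proof -
    have "?f \<bullet> (cov (Suc t) H *v ?f) = (pvar t H - \<sigma>\<^sup>2) * \<sigma>\<^sup>2 / pvar t H"
      unfolding cov_mult_vec_Suc using pos by (simp add: inner_diff_right s field_simps power2_eq_square)
    then show ?thesis using pos by (simp add: a_def inner_commute del: cov.simps)
  qed
  have "(v - a) \<bullet> (prec (Suc t) H *v (v - a)) =
      v \<bullet> (prec (Suc t) H *v v) - 2 * (y / \<sigma>\<^sup>2) * (v \<bullet> ?f) + (y / \<sigma>\<^sup>2) * (a \<bullet> ?f)"
  proof -
    have "a \<bullet> (prec (Suc t) H *v v) = (y / \<sigma>\<^sup>2) * (v \<bullet> ?f)"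
      unfolding prec_sym pa by (simp add: inner_commute)
    then show ?thesis
      by (simp add: matrix_vector_mult_diff_distrib pa inner_diff_left inner_diff_right diff_divide_distrib
          right_diff_distrib del: prec.simps cov.simps)
  qed
  also have "v \<bullet> (prec (Suc t) H *v v) = v \<bullet> (prec t H *v v) + (v \<bullet> ?f)\<^sup>2 / \<sigma>\<^sup>2"
    unfolding prec_mult_vec_Suc by (simp add: inner_add_right inner_commute power2_eq_square)
  finally have "(v - a) \<bullet> (prec (Suc t) H *v (v - a)) = v \<bullet> (prec t H *v v) +
    ((v \<bullet> ?f)\<^sup>2 - 2 * y * (v \<bullet> ?f) + y\<^sup>2 * (pvar t H - \<sigma>\<^sup>2) / pvar t H) / \<sigma>\<^sup>2"
    unfolding af by (simp add: add_divide_distrib diff_divide_distrib power2_eq_square mult_ac del: prec.simps)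
  also have "y\<^sup>2 * (pvar t H - \<sigma>\<^sup>2) / pvar t H = y\<^sup>2 - \<sigma>\<^sup>2 * (y\<^sup>2 / pvar t H)"
    using pos by (simp add: diff_divide_distrib right_diff_distrib)
  also have "((v \<bullet> ?f)\<^sup>2 - 2 * y * (v \<bullet> ?f) + (y\<^sup>2 - \<sigma>\<^sup>2 * (y\<^sup>2 / pvar t H))) / \<sigma>\<^sup>2 =
    (y - v \<bullet> ?f)\<^sup>2 / \<sigma>\<^sup>2 - y\<^sup>2 / pvar t H"
    using pos by (simp add: add_divide_distrib diff_divide_distrib power2_diff)
  finally show ?thesis by simp
qed

text \<open>The joint density of parameter and next output, factored in both orders: prior times
  likelihood, and predictive density times posterior. The exponents agree by
  \<open>posterior_update\<close>.\<close>

lemma bayes: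
  "posterior t H z * normal_density 0 \<sigma> (y - (z - est t H) \<bullet> \<phi> (H t)) =
     normal_density 0 (sqrt (pvar t H)) y * posterior (Suc t) (H(Suc t := y)) z"
proof -
  let ?H = "H(Suc t := y)"
  have pos: "pvar t H > 0" by (rule pvar_pos)
  have c: "cov (Suc t) ?H = cov (Suc t) H" "prec (Suc t) ?H = prec (Suc t) H"
    "normalizer (Suc t) ?H = normalizer (Suc t) H" "est t ?H = est t H"
    using cov_cong[of t ?H H] prec_cong[of t ?H H] normalizer_cong[of t ?H H] pvar_cong[of t ?H H]
      est_cong[of t ?H H] by simp_all
  let ?v = "z - est t H" let ?a = "(y / \<sigma>\<^sup>2) *\<^sub>R (cov (Suc t) H *v \<phi> (H t))"
  have e: "z - est (Suc t) ?H = ?v - ?a"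
    unfolding est.simps(2) c by (simp add: divide_inverse mult_ac del: cov.simps)
  have x: "exp (- (?v \<bullet> (prec t H *v ?v)) / 2) * exp (- (y - ?v \<bullet> \<phi> (H t))\<^sup>2 / (2 * \<sigma>\<^sup>2)) =
    exp (- y\<^sup>2 / (2 * pvar t H)) * exp (- ((?v - ?a) \<bullet> (prec (Suc t) H *v (?v - ?a))) / 2)"
    unfolding exp_add[symmetric]
  proof (rule arg_cong[where f=exp])
    have "- p / 2 + - q / (2 * \<sigma>\<^sup>2) = - r / (2 * pvar t H) + - u / 2"
      if "p + q / \<sigma>\<^sup>2 = r / pvar t H + u" for p q r u :: real
    proof -
      have "- p / 2 + - q / (2 * \<sigma>\<^sup>2) = - (p + q / \<sigma>\<^sup>2) / 2" by (simp add: add_divide_distrib)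
      then show ?thesis unfolding that by (simp add: add_divide_distrib)
    qed
    from this[OF posterior_update]
    show "- (?v \<bullet> (prec t H *v ?v)) / 2 + - (y - ?v \<bullet> \<phi> (H t))\<^sup>2 / (2 * \<sigma>\<^sup>2) =
      - y\<^sup>2 / (2 * pvar t H) + - ((?v - ?a) \<bullet> (prec (Suc t) H *v (?v - ?a))) / 2" .
  qed
  \<comment> \<open>The factor \<open>sqrt (pvar t H) / \<sigma>\<close> in the recursion of
    \<open>normalizer\<close> is exactly the ratio of the two normal prefactors.\<close>
  have n: "normalizer t H * (1 / sqrt (2 * pi * \<sigma>\<^sup>2)) =
     (1 / sqrt (2 * pi * pvar t H)) * normalizer (Suc t) H"
    using pos sigma_pos by (simp add: real_sqrt_mult)
  have "a * b * (d * e') = f * g * (h * k)" if "a * d = f * h" "b * e' = g * k" for a b d e' f g h k :: real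
    using that by algebra
  from this[OF n x] pos show ?thesis
    unfolding posterior_def normal_density_def e c by simp
qed

section \<open>Measurability and total mass of the posterior density\<close>

lemma normalizer_pos: "normalizer t H > 0"
  by (induction t) (simp_all add: sigma_pos pvar_pos)

lemma posterior_nonneg: "posterior t H z \<ge> 0"
  using normalizer_pos[of t H] by (simp add: posterior_def)

lemma posterior_0: "posterior 0 H = std_normal_vec_density \<theta>0"
  by (simp add: fun_eq_iff posterior_def std_normal_vec_density_def power2_norm_eq_inner)

lemma measurable_history:
  fixes H :: "'b \<Rightarrow> nat \<Rightarrow> real"
  assumes "\<And>s. s \<le> t \<Longrightarrow> (\<lambda>x. H x s) \<in> borel_measurable N"
  shows prec_measurable: "(\<lambda>x. prec t (H x)) \<in> borel_measurable N"
    and est_measurable: "(\<lambda>x. est t (H x)) \<in> borel_measurable N"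
    and pvar_measurable: "(\<lambda>x. pvar t (H x)) \<in> borel_measurable N"
    and normalizer_measurable: "(\<lambda>x. normalizer t (H x)) \<in> borel_measurable N"
proof -
  have phi: "(\<lambda>x. \<phi> (H x s)) \<in> borel_measurable N" if "s \<le> t" for s
    using assms[OF that] by measurable
  have 1: "(\<lambda>x. cov s (H x)) \<in> borel_measurable N" if "s \<le> t" for s
    using that
  proof (induction s)
    case (Suc s)
    have [measurable]: "(\<lambda>x. cov s (H x)) \<in> borel_measurable N" "(\<lambda>x. \<phi> (H x s)) \<in> borel_measurable N"
      using Suc phi by auto
    show ?case by simp
  qed simp
  have 2: "(\<lambda>x. pvar s (H x)) \<in> borel_measurable N" if "s \<le> t" for s
    using phi[OF that] 1[OF that] unfolding pvar_def by measurable
  then show "(\<lambda>x. pvar t (H x)) \<in> borel_measurable N" by blast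
  have "(\<lambda>x. prec s (H x)) \<in> borel_measurable N" if "s \<le> t" for s
    using that
  proof (induction s)
    case (Suc s)
    have [measurable]: "(\<lambda>x. prec s (H x)) \<in> borel_measurable N" "(\<lambda>x. \<phi> (H x s)) \<in> borel_measurable N"
      using Suc phi by auto
    show ?case by simp
  qed simp
  then show "(\<lambda>x. prec t (H x)) \<in> borel_measurable N" by blast
  have "(\<lambda>x. est s (H x)) \<in> borel_measurable N" if "s \<le> t" for s
    using that
  proof (induction s)
    case (Suc s)
    have [measurable]: "(\<lambda>x. est s (H x)) \<in> borel_measurable N" "(\<lambda>x. \<phi> (H x s)) \<in> borel_measurable N"
      "(\<lambda>x. cov (Suc s) (H x)) \<in> borel_measurable N" "(\<lambda>x. H x (Suc s)) \<in> borel_measurable N"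
      using Suc phi assms 1[of "Suc s"] by (auto simp del: cov.simps)
    show ?case unfolding est.simps by measurable
  qed simp
  then show "(\<lambda>x. est t (H x)) \<in> borel_measurable N" by blast
  have "(\<lambda>x. normalizer s (H x)) \<in> borel_measurable N" if "s \<le> t" for s
    using that
  proof (induction s)
    case (Suc s)
    have [measurable]: "(\<lambda>x. normalizer s (H x)) \<in> borel_measurable N" "(\<lambda>x. pvar s (H x)) \<in> borel_measurable N"
      using Suc 2[of s] by auto
    show ?case by simp
  qed simp
  then show "(\<lambda>x. normalizer t (H x)) \<in> borel_measurable N" by blast
qed

lemma posterior_measurable [measurable (raw)]:
  assumes "\<And>s. s \<le> t \<Longrightarrow> (\<lambda>x. H x s) \<in> borel_measurable N"
    and [measurable]: "z \<in> borel_measurable N"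
  shows "(\<lambda>x. posterior t (H x) (z x)) \<in> borel_measurable N"
  unfolding posterior_def
  using prec_measurable[OF assms(1)] est_measurable[OF assms(1)] normalizer_measurable[OF assms(1)]
  by measurable

lemma posterior_integral_translate:
  "(\<integral>\<^sup>+ z. posterior t H z \<partial>lborel) =
    (\<integral>\<^sup>+ z. ennreal (normalizer t H * exp (- (z \<bullet> (prec t H *v z)) / 2)) \<partial>lborel)"
proof -
  have "(\<lambda>z. ennreal (posterior t H z)) \<in> borel_measurable borel" by measurable
  from nn_integral_lborel_translate[OF this, of "est t H", symmetric] show ?thesis
    by (simp add: posterior_def)
qed

text \<open>The integral of the posterior at time \<open>Suc t\<close> does not depend on the last output, which enters
  only through the mean, so integrating Bayes' rule over that output determines it without computing
  determinants.\<close>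

lemma posterior_integral:
  assumes base: "(\<integral>\<^sup>+ z. std_normal_vec_density \<theta>0 z \<partial>lborel) = 1"
  shows "(\<integral>\<^sup>+ z. posterior t H z \<partial>lborel) = 1"
proof (induction t arbitrary: H)
  case 0
  show ?case using base by (simp add: posterior_0)
next
  case (Suc t)
  define K where "K = (\<integral>\<^sup>+ z. posterior (Suc t) H z \<partial>lborel)"
  have K: "(\<integral>\<^sup>+ z. posterior (Suc t) (H(Suc t := y)) z \<partial>lborel) = K" for y
  proof -
    let ?H = "H(Suc t := y)"
    have "prec (Suc t) ?H = prec (Suc t) H" "normalizer (Suc t) ?H = normalizer (Suc t) H"
      using prec_cong[of t ?H H] normalizer_cong[of t ?H H] pvar_cong[of t ?H H] by simp_all
    then show ?thesis by (simp only: K_def posterior_integral_translate)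
  qed
  have m: "(\<lambda>y. (H(Suc t := y)) s) \<in> borel_measurable borel" for s
    by (cases "s = Suc t") simp_all
  have sp: "sqrt (pvar t H) > 0" using pvar_pos by simp
  \<comment> \<open>A factor 1 is inserted, the mass of the noise density over the next output;
    Fubini and \<open>bayes\<close> turn the same double integral into \<open>K\<close>.\<close>
  have "1 = (\<integral>\<^sup>+ z. ennreal (posterior t H z) *
       (\<integral>\<^sup>+ y. normal_density 0 \<sigma> (y - (z - est t H) \<bullet> \<phi> (H t)) \<partial>lborel) \<partial>lborel)"
  proof -
    have "(\<integral>\<^sup>+ y. normal_density 0 \<sigma> (y - c) \<partial>lborel) = 1" for c
      using nn_integral_lborel_translate[of "normal_density 0 \<sigma>" "-c"] sigma_pos
      by (simp add: normal_density_integral)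
    then show ?thesis using Suc by simp
  qed
  also have "\<dots> = (\<integral>\<^sup>+ z. \<integral>\<^sup>+ y. ennreal (posterior t H z *
       normal_density 0 \<sigma> (y - (z - est t H) \<bullet> \<phi> (H t))) \<partial>lborel \<partial>lborel)"
    by (simp add: nn_integral_cmult[symmetric] ennreal_mult posterior_nonneg)
  also have "\<dots> = (\<integral>\<^sup>+ y. \<integral>\<^sup>+ z. ennreal (posterior t H z *
       normal_density 0 \<sigma> (y - (z - est t H) \<bullet> \<phi> (H t))) \<partial>lborel \<partial>lborel)"
    by (rule lborel_pair.Fubini') measurable
  also have "\<dots> = (\<integral>\<^sup>+ y. normal_density 0 (sqrt (pvar t H)) y *
      (\<integral>\<^sup>+ z. posterior (Suc t) (H(Suc t := y)) z \<partial>lborel) \<partial>lborel)"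
    unfolding bayes by (simp add: nn_integral_cmult[symmetric] ennreal_mult posterior_nonneg
        posterior_measurable[OF m])
  also have "\<dots> = K"
    unfolding K by (subst nn_integral_multc) (simp_all add: normal_density_integral[OF sp])
  finally show ?case by (simp add: K_def)
qed

end

section \<open>Conditional laws in the closed loop\<close>

text \<open>The loop with the control eliminated: an output is the estimation error along the
  regressor plus noise, and the filter is evaluated on the observed path.\<close>

locale closed_loop_system = prob_space M + regulator \<phi> \<sigma> \<theta>0
  for M :: "'a measure" and \<phi> :: "real \<Rightarrow> real ^ 'n" and \<sigma> :: real and \<theta>0 :: "real ^ 'n" +
  fixes y0 :: real and \<theta> :: "'a \<Rightarrow> real ^ 'n" and w y :: "nat \<Rightarrow> 'a \<Rightarrow> real"
  assumes noise_indep: "indep_vars (\<lambda>_. borel) w {1..}"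
    and noise_normal: "\<And>t. t \<ge> 1 \<Longrightarrow> distributed M lborel (w t) (normal_density 0 \<sigma>)"
    and param_normal: "distributed M lborel \<theta> (std_normal_vec_density \<theta>0)"
    and param_indep: "indep_set (sets (vimage_algebra (space M) \<theta> borel))
         (sets (gen_sigma M w {1..}))"
    and output_0: "\<And>\<omega>. \<omega> \<in> space M \<Longrightarrow> y 0 \<omega> = y0"
    and output_Suc: "\<And>t \<omega>. \<omega> \<in> space M \<Longrightarrow>
      y (Suc t) \<omega> = (\<theta> \<omega> - est t (\<lambda>s. y s \<omega>)) \<bullet> \<phi> (y t \<omega>) + w (Suc t) \<omega>"
begin

section \<open>Independence of the next noise from the past\<close>

lemma param_measurable [measurable]: "\<theta> \<in> borel_measurable M"
  using distributed_measurable[OF param_normal] by simp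

lemma noise_measurable: "t \<ge> 1 \<Longrightarrow> w t \<in> borel_measurable M"
  using distributed_measurable[OF noise_normal] by simp

text \<open>The parameter takes the free index 0, as the noise starts at 1. Families of events,
  rather than variables, accommodate the two different value types.\<close>

definition source :: "nat \<Rightarrow> 'a set set" where
  "source i = (if i = 0 then {\<theta> -` A \<inter> space M | A. A \<in> sets borel}
     else {w i -` A \<inter> space M | A. A \<in> sets borel})"

text \<open>Merges the two independence assumptions: independence of \<open>\<theta>\<close> from
  the whole noise splits off the event with index 0, and mutual independence of the noise factors
  the rest.\<close>

lemma indep_source: "indep_sets source UNIV"
  unfolding indep_sets_def
proof (intro conjI ballI allI impI)
  fix i show "source i \<subseteq> events"
    using noise_measurable[of i] by (auto simp: source_def)
next
  fix J A assume J: "J \<noteq> {}" "finite J" and A: "A \<in> Pi J source"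
  have pos: "prob (\<Inter>j\<in>K. A j) = (\<Prod>j\<in>K. prob (A j))" if K: "K \<subseteq> J - {0}" "K \<noteq> {}" for K
  proof -
    have 1: "indep_sets (\<lambda>i. {w i -` A \<inter> space M | A. A \<in> sets borel}) {1..}"
      using noise_indep unfolding indep_vars_def2 by simp
    have 2: "K \<subseteq> {1..}" using K by (auto simp: Suc_le_eq subset_iff)
    have 3: "finite K" using K J by (auto intro: finite_subset)
    have 4: "\<forall>j\<in>K. A j \<in> {w j -` A \<inter> space M | A. A \<in> sets borel}"
    proof
      fix j assume "j \<in> K"
      then have "j \<noteq> 0" "A j \<in> source j" using K A by auto
      then show "A j \<in> {w j -` A \<inter> space M | A. A \<in> sets borel}" by (simp add: source_def)
    qed
    show ?thesis using 1 2 K(2) 3 4 by (rule indep_setsD)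
  qed
  show "prob (\<Inter>j\<in>J. A j) = (\<Prod>j\<in>J. prob (A j))"
  proof (cases "0 \<in> J")
    case False
    then show ?thesis using pos[of J] J by auto
  next
    case True
    define K where "K = J - {0}"
    show ?thesis
    proof (cases "K = {}")
      case True
      then have "J = {0}" using \<open>0 \<in> J\<close> by (auto simp: K_def)
      then show ?thesis by simp
    next
      case False
      have JK: "J = insert 0 K" "finite K" "0 \<notin> K" using \<open>0 \<in> J\<close> J by (auto simp: K_def)
      have gs: "sets (gen_sigma M w {1..}) =
          sigma_sets (space M) (\<Union>i\<in>{1..}. {w i -` A \<inter> space M | A. A \<in> sets borel})"
        unfolding gen_sigma_def by (rule sets_measure_of) auto
      have "A j \<in> sets (gen_sigma M w {1..})" if "j \<in> K" for j
      proof -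
        have "j \<noteq> 0" using that by (simp add: K_def)
        moreover have "A j \<in> source j" using that A JK(1) by auto
        ultimately show ?thesis unfolding gs by (intro sigma_sets.Basic UN_I[of j]) (simp_all add: source_def)
      qed
      then have "(\<Inter>j\<in>K. A j) \<in> sets (gen_sigma M w {1..})"
        using False JK by (intro sets.finite_INT) auto
      moreover have "A 0 \<in> sets (vimage_algebra (space M) \<theta> borel)"
      proof -
        have "A 0 \<in> source 0" using A JK by auto
        then show ?thesis by (simp add: source_def sets_vimage_algebra2)
      qed
      ultimately have "prob (A 0 \<inter> (\<Inter>j\<in>K. A j)) = prob (A 0) * prob (\<Inter>j\<in>K. A j)"
        by (intro indep_setD[OF param_indep])
      moreover have "prob (\<Inter>j\<in>K. A j) = (\<Prod>j\<in>K. prob (A j))"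
        using False by (intro pos) (auto simp: K_def)
      ultimately show ?thesis using JK(2,3) unfolding JK(1) by simp
    qed
  qed
qed

text \<open>The information in \<open>\<theta>\<close> and the noise up to time \<open>t\<close>. It
  makes all outputs up to time \<open>t\<close> measurable and is still independent of
  \<open>w (Suc t)\<close>.\<close>

definition past :: "nat \<Rightarrow> 'a measure" where
  "past t = sigma (space M) (\<Union>i\<in>{..t}. source i)"

lemma source_events: "source i \<subseteq> events"
  using indep_source by (simp add: indep_sets_def)

lemma sets_past: "sets (past t) = sigma_sets (space M) (\<Union>i\<in>{..t}. source i)"
  and space_past [simp]: "space (past t) = space M"
proof -
  have "(\<Union>i\<in>{..t}. source i) \<subseteq> Pow (space M)"
    using source_events sets.sets_into_space by blast
  then show "sets (past t) = sigma_sets (space M) (\<Union>i\<in>{..t}. source i)" "space (past t) = space M"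
    unfolding past_def by (rule sets_measure_of, rule space_measure_of)
qed

lemma Int_stable_source: "Int_stable (source i)"
proof (cases "i = 0")
  case True
  show ?thesis
  proof (rule Int_stableI)
    fix a b assume "a \<in> source i" "b \<in> source i"
    then obtain A B where "A \<in> sets borel" "B \<in> sets borel"
      "a = \<theta> -` A \<inter> space M" "b = \<theta> -` B \<inter> space M" using True by (auto simp: source_def)
    then show "a \<inter> b \<in> source i"
      using True by (auto simp: source_def intro!: exI[of _ "A \<inter> B"])
  qed
next
  case False
  show ?thesis
  proof (rule Int_stableI)
    fix a b assume "a \<in> source i" "b \<in> source i"
    then obtain A B where "A \<in> sets borel" "B \<in> sets borel"
      "a = w i -` A \<inter> space M" "b = w i -` B \<inter> space M" using False by (auto simp: source_def)
    then show "a \<inter> b \<in> source i"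
      using False by (auto simp: source_def intro!: exI[of _ "A \<inter> B"])
  qed
qed

text \<open>Grouping of independent families over the disjoint index blocks \<open>{..t}\<close> and
  \<open>{Suc t}\<close>, available because each generator is closed under intersection.\<close>

lemma past_indep_noise:
  assumes a: "a \<in> sets (past t)" and B: "B \<in> sets borel"
  shows "prob (a \<inter> (w (Suc t) -` B \<inter> space M)) = prob a * prob (w (Suc t) -` B \<inter> space M)"
proof -
  define I where "I = (\<lambda>b. if b then {..t} else {Suc t})"
  have "indep_sets (\<lambda>b. sigma_sets (space M) (\<Union>i\<in>I b. source i)) UNIV"
  proof (rule indep_sets_collect_sigma)
    show "indep_sets source (\<Union>j\<in>UNIV. I j)"
      using indep_source by (rule indep_sets_mono_index[rotated]) auto
    show "disjoint_family_on I UNIV" by (auto simp: disjoint_family_on_def I_def)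
  qed (rule Int_stable_source)
  moreover have "(\<lambda>b. sigma_sets (space M) (\<Union>i\<in>I b. source i)) =
      case_bool (sets (past t)) (sigma_sets (space M) (source (Suc t)))"
    by (auto simp: fun_eq_iff I_def sets_past split: bool.split)
  ultimately have "indep_set (sets (past t)) (sigma_sets (space M) (source (Suc t)))"
    by (simp add: indep_set_def)
  from indep_setD[OF this a] show ?thesis using B by (auto simp: source_def)
qed

lemma past_le: "sets (past t) \<subseteq> events"
  unfolding sets_past using source_events by (intro sets.sigma_sets_subset) auto

lemma measurable_past: "X \<in> measurable (past t) N \<Longrightarrow> X \<in> measurable M N"
  using past_le by (auto simp: measurable_def)

text \<open>By independence the joint law of \<open>X\<close> and \<open>w (Suc t)\<close> is a
  product, so the noise is integrated out with the past frozen.\<close>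

lemma past_noise_integral:
  fixes k :: "'b \<times> real \<Rightarrow> ennreal"
  assumes X: "X \<in> measurable (past t) N"
    and k [measurable]: "k \<in> borel_measurable (N \<Otimes>\<^sub>M borel)"
  shows "(\<integral>\<^sup>+ \<omega>. k (X \<omega>, w (Suc t) \<omega>) \<partial>M) =
    (\<integral>\<^sup>+ \<omega>. \<integral>\<^sup>+ c. normal_density 0 \<sigma> c * k (X \<omega>, c) \<partial>lborel \<partial>M)"
proof -
  have [measurable]: "X \<in> measurable M N" using X by (rule measurable_past)
  have [measurable]: "w (Suc t) \<in> borel_measurable M" by (rule noise_measurable) simp
  interpret D: prob_space "distr M N X" by (rule prob_space_distr) measurable
  interpret W: prob_space "distr M borel (w (Suc t))" by (rule prob_space_distr) measurable
  have eq: "distr M N X \<Otimes>\<^sub>M distr M borel (w (Suc t)) =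
      distr M (N \<Otimes>\<^sub>M borel) (\<lambda>\<omega>. (X \<omega>, w (Suc t) \<omega>))"
  proof (rule pair_measure_eqI)
    fix A B assume "A \<in> sets (distr M N X)" "B \<in> sets (distr M borel (w (Suc t)))"
    then have [measurable]: "A \<in> sets N" "B \<in> sets borel" by auto
    have "X -` A \<inter> space M \<in> sets (past t)" using measurable_sets[OF X \<open>A \<in> sets N\<close>] by simp
    from past_indep_noise[OF this \<open>B \<in> sets borel\<close>]
    have "emeasure M ((X -` A \<inter> space M) \<inter> (w (Suc t) -` B \<inter> space M)) =
        emeasure M (X -` A \<inter> space M) * emeasure M (w (Suc t) -` B \<inter> space M)"
      by (simp add: emeasure_eq_measure ennreal_mult)
    also have "(X -` A \<inter> space M) \<inter> (w (Suc t) -` B \<inter> space M) =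
        (\<lambda>\<omega>. (X \<omega>, w (Suc t) \<omega>)) -` (A \<times> B) \<inter> space M" by auto
    finally show "emeasure (distr M N X) A * emeasure (distr M borel (w (Suc t))) B =
        emeasure (distr M (N \<Otimes>\<^sub>M borel) (\<lambda>\<omega>. (X \<omega>, w (Suc t) \<omega>))) (A \<times> B)"
      by (simp add: emeasure_distr)
  qed (auto intro: D.sigma_finite_measure_axioms W.sigma_finite_measure_axioms cong: sets_pair_measure_cong)
  have W: "distr M borel (w (Suc t)) = density lborel (normal_density 0 \<sigma>)"
    using noise_normal[of "Suc t"] distr_cong[of M M borel lborel "w (Suc t)"]
    by (simp add: distributed_def)
  have km: "k \<in> borel_measurable (distr M N X \<Otimes>\<^sub>M distr M borel (w (Suc t)))"
    using k by (simp cong: measurable_cong_sets sets_pair_measure_cong)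
  have "(\<integral>\<^sup>+ \<omega>. k (X \<omega>, w (Suc t) \<omega>) \<partial>M) =
      integral\<^sup>N (distr M (N \<Otimes>\<^sub>M borel) (\<lambda>\<omega>. (X \<omega>, w (Suc t) \<omega>))) k"
    by (simp add: nn_integral_distr)
  also have "\<dots> = (\<integral>\<^sup>+ x. \<integral>\<^sup>+ c. k (x, c) \<partial>distr M borel (w (Suc t)) \<partial>distr M N X)"
    unfolding eq[symmetric] by (rule sigma_finite_measure.nn_integral_fst[OF W.sigma_finite_measure_axioms km, symmetric])
  also have "\<dots> = (\<integral>\<^sup>+ \<omega>. \<integral>\<^sup>+ c. k (X \<omega>, c) \<partial>distr M borel (w (Suc t)) \<partial>M)"
    unfolding W by (subst nn_integral_distr) (auto intro!: sigma_finite_measure.borel_measurable_nn_integral W.sigma_finite_measure_axioms[unfolded W])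
  also have "\<dots> = (\<integral>\<^sup>+ \<omega>. \<integral>\<^sup>+ c. normal_density 0 \<sigma> c * k (X \<omega>, c) \<partial>lborel \<partial>M)"
  proof (rule nn_integral_cong)
    fix \<omega> assume "\<omega> \<in> space M"
    then have [measurable]: "(\<lambda>c. k (X \<omega>, c)) \<in> borel_measurable borel"
      using measurable_space[OF \<open>X \<in> measurable M N\<close>] by measurable
    show "(\<integral>\<^sup>+ c. k (X \<omega>, c) \<partial>distr M borel (w (Suc t))) =
      (\<integral>\<^sup>+ c. normal_density 0 \<sigma> c * k (X \<omega>, c) \<partial>lborel)"
      unfolding W by (subst nn_integral_density) auto
  qed
  finally show ?thesis .
qed

lemma param_past: "\<theta> \<in> borel_measurable (past t)"
proof (rule measurableI)
  fix A :: "(real ^ 'n) set" assume "A \<in> sets borel"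
  then show "\<theta> -` A \<inter> space (past t) \<in> sets (past t)"
    unfolding sets_past by (auto simp: source_def intro!: sigma_sets.Basic)
qed simp

lemma noise_past:
  assumes "1 \<le> i" "i \<le> t"
  shows "w i \<in> borel_measurable (past t)"
proof (rule measurableI)
  fix A :: "real set" assume "A \<in> sets borel"
  then have "w i -` A \<inter> space M \<in> source i" using assms by (auto simp: source_def)
  then show "w i -` A \<inter> space (past t) \<in> sets (past t)"
    unfolding sets_past using assms by (auto intro!: sigma_sets.Basic)
qed simp

lemma output_past: "s \<le> t \<Longrightarrow> y s \<in> borel_measurable (past t)"
proof (induction s rule: less_induct)
  case (less s)
  show ?case
  proof (cases s)
    case 0
    have "y s \<in> borel_measurable (past t) \<longleftrightarrow> (\<lambda>_. y0) \<in> borel_measurable (past t)"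
      using 0 output_0 by (intro measurable_cong) auto
    then show ?thesis by simp
  next
    case (Suc r)
    have [measurable]: "y r \<in> borel_measurable (past t)" "w (Suc r) \<in> borel_measurable (past t)"
      "(\<lambda>\<omega>. est r (\<lambda>s. y s \<omega>)) \<in> borel_measurable (past t)" "\<theta> \<in> borel_measurable (past t)"
      using less Suc by (auto intro!: est_measurable noise_past param_past)
    have "y s \<in> borel_measurable (past t) \<longleftrightarrow>
      (\<lambda>\<omega>. (\<theta> \<omega> - est r (\<lambda>s. y s \<omega>)) \<bullet> \<phi> (y r \<omega>) + w (Suc r) \<omega>) \<in> borel_measurable (past t)"
      using Suc output_Suc by (intro measurable_cong) auto
    then show ?thesis by simp
  qed
qed

lemma output_measurable [measurable]: "y t \<in> borel_measurable M"
  using output_past[of t t] by (auto intro: measurable_past)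

section \<open>Joint law of the parameter and the output history\<close>

abbreviation histories :: "nat \<Rightarrow> (nat \<Rightarrow> real) measure" where
  "histories t \<equiv> Pi\<^sub>M {..t} (\<lambda>_. borel)"

text \<open>Truncation to \<open>{..t}\<close> makes the history a point of the finite product space
  \<open>histories t\<close>.\<close>

definition hist :: "nat \<Rightarrow> 'a \<Rightarrow> nat \<Rightarrow> real" where
  "hist t \<omega> = (\<lambda>s\<in>{..t}. y s \<omega>)"

lemma hist_past: "hist t \<in> measurable (past t) (histories t)"
  unfolding hist_def by (intro measurable_restrict output_past) auto

lemma hist_measurable [measurable]: "hist t \<in> measurable M (histories t)"
  using hist_past by (rule measurable_past)

lemma hist_Suc: "\<omega> \<in> space M \<Longrightarrow> hist (Suc t) \<omega> = (hist t \<omega>)(Suc t :=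
    (\<theta> \<omega> - est t (hist t \<omega>)) \<bullet> \<phi> (hist t \<omega> t) + w (Suc t) \<omega>)"
  using est_cong[of t "hist t \<omega>" "\<lambda>s. y s \<omega>"] output_Suc[of \<omega> t]
  by (auto simp: hist_def fun_eq_iff)

lemma upd_measurable [measurable (raw)]:
  assumes "H \<in> measurable N (histories t)" "c \<in> borel_measurable N"
  shows "(\<lambda>x. (H x)(Suc t := c x)) \<in> measurable N (histories (Suc t))"
  using assms by (intro measurable_fun_upd[where J="{..t}"]) auto

lemma histories_component:
  assumes "H \<in> measurable N (histories t)" "s \<le> t"
  shows "(\<lambda>x. H x s) \<in> borel_measurable N"
  using measurable_compose[OF assms(1) measurable_component_singleton[of s "{..t}"]] assms(2) by simp

lemma histories_measurable [measurable (raw)]: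
  assumes "H \<in> measurable N (histories t)"
  shows "(\<lambda>x. H x t) \<in> borel_measurable N"
    and "(\<lambda>x. est t (H x)) \<in> borel_measurable N"
    and "(\<lambda>x. pvar t (H x)) \<in> borel_measurable N"
  using histories_component[OF assms] by (auto intro: est_measurable pvar_measurable)

lemma posterior_histories [measurable (raw)]:
  assumes "H \<in> measurable N (histories t)" "z \<in> borel_measurable N"
  shows "(\<lambda>x. posterior t (H x) (z x)) \<in> borel_measurable N"
  using histories_component[OF assms(1)] assms(2) by (auto intro: posterior_measurable)

text \<open>Comes without a Gaussian integral: a density of the law of \<open>\<theta>\<close> has
  total mass 1.\<close>

lemma param_density_integral: "(\<integral>\<^sup>+ z. std_normal_vec_density \<theta>0 z \<partial>lborel) = 1"
  using distributed_nn_integral[OF param_normal, of "\<lambda>_. 1"] by (simp add: emeasure_space_1)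

text \<open>The fresh noise is integrated out given the past, the hypothesis replaces
  \<open>\<theta>\<close> by its posterior density at time \<open>t\<close>, and after Fubini
  \<open>bayes\<close> exchanges prior and likelihood for predictive density and new
  posterior.\<close>

lemma posterior_step:
  assumes IH: "\<And>h. h \<in> borel_measurable (borel \<Otimes>\<^sub>M histories t) \<Longrightarrow>
      (\<integral>\<^sup>+ \<omega>. h (\<theta> \<omega>, hist t \<omega>) \<partial>M) =
      (\<integral>\<^sup>+ \<omega>. \<integral>\<^sup>+ z. ennreal (posterior t (hist t \<omega>) z) * h (z, hist t \<omega>) \<partial>lborel \<partial>M)"
    and h [measurable]: "h \<in> borel_measurable (borel \<Otimes>\<^sub>M histories (Suc t))"
  shows "(\<integral>\<^sup>+ \<omega>. h (\<theta> \<omega>, hist (Suc t) \<omega>) \<partial>M) =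
    (\<integral>\<^sup>+ \<omega>. \<integral>\<^sup>+ c. ennreal (normal_density 0 (sqrt (pvar t (hist t \<omega>))) c) *
       (\<integral>\<^sup>+ z. ennreal (posterior (Suc t) ((hist t \<omega>)(Suc t := c)) z) * h (z, (hist t \<omega>)(Suc t := c)) \<partial>lborel)
       \<partial>lborel \<partial>M)"
proof -
  \<comment> \<open>The mean of \<open>h\<close> when the parameter is \<open>z\<close> and the
    history is \<open>H\<close>, as an integral over the next output \<open>c\<close>.\<close>
  define k where "k = (\<lambda>(z, H). \<integral>\<^sup>+ c. ennreal (normal_density 0 \<sigma> (c - (z - est t H) \<bullet> \<phi> (H t))) *
      h (z, H(Suc t := c)) \<partial>lborel)"
  have [measurable]: "k \<in> borel_measurable (borel \<Otimes>\<^sub>M histories t)"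
    unfolding k_def split_beta by measurable
  have "(\<lambda>((z, H), c). h (z, H(Suc t := (z - est t H) \<bullet> \<phi> (H t) + c)))
      \<in> borel_measurable ((borel \<Otimes>\<^sub>M histories t) \<Otimes>\<^sub>M borel)"
    unfolding split_beta by measurable
  note shifted = past_noise_integral[OF measurable_Pair[OF param_past hist_past] this]
  have "(\<integral>\<^sup>+ \<omega>. h (\<theta> \<omega>, hist (Suc t) \<omega>) \<partial>M) =
    (\<integral>\<^sup>+ \<omega>. (\<lambda>((z, H), c). h (z, H(Suc t := (z - est t H) \<bullet> \<phi> (H t) + c))) ((\<theta> \<omega>, hist t \<omega>), w (Suc t) \<omega>) \<partial>M)"
    by (intro nn_integral_cong) (simp add: hist_Suc)
  also have "\<dots> = (\<integral>\<^sup>+ \<omega>. \<integral>\<^sup>+ c. ennreal (normal_density 0 \<sigma> c) *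
      h (\<theta> \<omega>, (hist t \<omega>)(Suc t := (\<theta> \<omega> - est t (hist t \<omega>)) \<bullet> \<phi> (hist t \<omega> t) + c)) \<partial>lborel \<partial>M)"
    unfolding shifted by simp
  \<comment> \<open>Translation by the conditional mean changes the integration variable from the
    noise to the output.\<close>
  also have "\<dots> = (\<integral>\<^sup>+ \<omega>. k (\<theta> \<omega>, hist t \<omega>) \<partial>M)"
  proof (rule nn_integral_cong)
    fix \<omega> assume "\<omega> \<in> space M"
    then have [measurable]: "hist t \<omega> \<in> space (histories t)"
      using measurable_space[OF hist_measurable] by blast
    let ?m = "(\<theta> \<omega> - est t (hist t \<omega>)) \<bullet> \<phi> (hist t \<omega> t)"
    have "(\<lambda>c. ennreal (normal_density 0 \<sigma> (c - ?m)) * h (\<theta> \<omega>, (hist t \<omega>)(Suc t := c))) \<in> borel_measurable borel"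
      by measurable
    from nn_integral_lborel_translate[OF this, of ?m]
    show "(\<integral>\<^sup>+ c. ennreal (normal_density 0 \<sigma> c) * h (\<theta> \<omega>, (hist t \<omega>)(Suc t := ?m + c)) \<partial>lborel) =
       k (\<theta> \<omega>, hist t \<omega>)" by (simp add: k_def)
  qed
  also have "\<dots> = (\<integral>\<^sup>+ \<omega>. \<integral>\<^sup>+ z. ennreal (posterior t (hist t \<omega>) z) * k (z, hist t \<omega>) \<partial>lborel \<partial>M)"
    by (rule IH) measurable
  also have "\<dots> = (\<integral>\<^sup>+ \<omega>. \<integral>\<^sup>+ c. ennreal (normal_density 0 (sqrt (pvar t (hist t \<omega>))) c) *
       (\<integral>\<^sup>+ z. ennreal (posterior (Suc t) ((hist t \<omega>)(Suc t := c)) z) * h (z, (hist t \<omega>)(Suc t := c)) \<partial>lborel)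
       \<partial>lborel \<partial>M)"
  proof (rule nn_integral_cong)
    fix \<omega> assume "\<omega> \<in> space M"
    define H where "H = hist t \<omega>"
    have [measurable]: "H \<in> space (histories t)"
      using measurable_space[OF hist_measurable \<open>\<omega> \<in> space M\<close>] by (simp add: H_def)
    have "(\<integral>\<^sup>+ z. ennreal (posterior t H z) * k (z, H) \<partial>lborel) =
      (\<integral>\<^sup>+ z. \<integral>\<^sup>+ c. ennreal (posterior t H z * normal_density 0 \<sigma> (c - (z - est t H) \<bullet> \<phi> (H t))) *
         h (z, H(Suc t := c)) \<partial>lborel \<partial>lborel)"
      unfolding k_def by (simp add: nn_integral_cmult[symmetric] ennreal_mult posterior_nonneg mult.assoc)
    also have "\<dots> = (\<integral>\<^sup>+ c. \<integral>\<^sup>+ z. ennreal (posterior t H z * normal_density 0 \<sigma> (c - (z - est t H) \<bullet> \<phi> (H t))) *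
         h (z, H(Suc t := c)) \<partial>lborel \<partial>lborel)"
      by (rule lborel_pair.Fubini') measurable
    also have "\<dots> = (\<integral>\<^sup>+ c. ennreal (normal_density 0 (sqrt (pvar t H)) c) *
       (\<integral>\<^sup>+ z. ennreal (posterior (Suc t) (H(Suc t := c)) z) * h (z, H(Suc t := c)) \<partial>lborel) \<partial>lborel)"
      unfolding bayes by (simp add: nn_integral_cmult[symmetric] ennreal_mult posterior_nonneg mult.assoc)
    finally show "(\<integral>\<^sup>+ z. ennreal (posterior t (hist t \<omega>) z) * k (z, hist t \<omega>) \<partial>lborel) = \<dots>"
      by (simp add: H_def)
  qed
  finally show ?thesis .
qed

text \<open>For an integrand free of the parameter, the posterior contributes its total mass 1 and
  the predictive density remains. The law at time \<open>t\<close> is a hypothesis because the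
  induction for \<open>posterior_law\<close> uses this step.\<close>

lemma predictive_step:
  assumes IH: "\<And>h. h \<in> borel_measurable (borel \<Otimes>\<^sub>M histories t) \<Longrightarrow>
      (\<integral>\<^sup>+ \<omega>. h (\<theta> \<omega>, hist t \<omega>) \<partial>M) =
      (\<integral>\<^sup>+ \<omega>. \<integral>\<^sup>+ z. ennreal (posterior t (hist t \<omega>) z) * h (z, hist t \<omega>) \<partial>lborel \<partial>M)"
    and k [measurable]: "k \<in> borel_measurable (histories (Suc t))"
  shows "(\<integral>\<^sup>+ \<omega>. k (hist (Suc t) \<omega>) \<partial>M) =
    (\<integral>\<^sup>+ \<omega>. \<integral>\<^sup>+ c. ennreal (normal_density 0 (sqrt (pvar t (hist t \<omega>))) c) *
       k ((hist t \<omega>)(Suc t := c)) \<partial>lborel \<partial>M)"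
proof -
  have "(\<lambda>p. k (snd p)) \<in> borel_measurable (borel \<Otimes>\<^sub>M histories (Suc t))" by measurable
  from posterior_step[OF IH this] show ?thesis
    by (simp add: nn_integral_multc posterior_integral[OF param_density_integral] posterior_nonneg
        posterior_measurable)
qed

text \<open>Bayes' rule in integrated form: the joint law of parameter and history disintegrates
  over the history. At time 0 the history is constant and the posterior is the prior.\<close>

lemma posterior_law:
  assumes "h \<in> borel_measurable (borel \<Otimes>\<^sub>M histories t)"
  shows "(\<integral>\<^sup>+ \<omega>. h (\<theta> \<omega>, hist t \<omega>) \<partial>M) =
      (\<integral>\<^sup>+ \<omega>. \<integral>\<^sup>+ z. ennreal (posterior t (hist t \<omega>) z) * h (z, hist t \<omega>) \<partial>lborel \<partial>M)"
  using assms
proof (induction t arbitrary: h)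
  case 0
  note [measurable] = 0
  define H where "H = (\<lambda>s\<in>{..0::nat}. y0)"
  have H: "hist 0 \<omega> = H" if "\<omega> \<in> space M" for \<omega>
    using output_0[OF that] by (auto simp: H_def hist_def)
  have [measurable]: "H \<in> space (histories 0)" by (simp add: H_def space_PiM)
  have "(\<integral>\<^sup>+ \<omega>. h (\<theta> \<omega>, hist 0 \<omega>) \<partial>M) = (\<integral>\<^sup>+ \<omega>. h (\<theta> \<omega>, H) \<partial>M)"
    by (intro nn_integral_cong) (simp add: H)
  also have "\<dots> = (\<integral>\<^sup>+ z. ennreal (posterior 0 H z) * h (z, H) \<partial>lborel)"
    unfolding posterior_0 by (rule distributed_nn_integral[OF param_normal, symmetric]) measurable
  also have "\<dots> = (\<integral>\<^sup>+ \<omega>. \<integral>\<^sup>+ z. ennreal (posterior 0 H z) * h (z, H) \<partial>lborel \<partial>M)"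
    by (simp add: emeasure_space_1)
  also have "\<dots> = (\<integral>\<^sup>+ \<omega>. \<integral>\<^sup>+ z. ennreal (posterior 0 (hist 0 \<omega>) z) * h (z, hist 0 \<omega>) \<partial>lborel \<partial>M)"
    by (intro nn_integral_cong) (simp add: H)
  finally show ?case .
next
  case (Suc t)
  note [measurable] = Suc.prems
  have "(\<lambda>H. \<integral>\<^sup>+ z. ennreal (posterior (Suc t) H z) * h (z, H) \<partial>lborel) \<in> borel_measurable (histories (Suc t))"
    by measurable
  \<comment> \<open>\<open>posterior_step\<close> gives the predictive average of the posterior
    integral of \<open>h\<close>; \<open>predictive_step\<close>, read from right to left, folds it
    into an expectation over \<open>hist (Suc t)\<close>.\<close>
  from predictive_step[OF Suc.IH this] posterior_step[OF Suc.IH Suc.prems] show ?case by simp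
qed

lemma predictive_law:
  assumes "k \<in> borel_measurable (histories (Suc t))"
  shows "(\<integral>\<^sup>+ \<omega>. k (hist (Suc t) \<omega>) \<partial>M) =
    (\<integral>\<^sup>+ \<omega>. \<integral>\<^sup>+ c. ennreal (normal_density 0 (sqrt (pvar t (hist t \<omega>))) c) *
       k ((hist t \<omega>)(Suc t := c)) \<partial>lborel \<partial>M)"
  by (rule predictive_step[OF posterior_law assms])

section \<open>Conditioning on the observed outputs\<close>

abbreviation obs :: "nat \<Rightarrow> 'a measure" where "obs t \<equiv> gen_sigma M y {0..t}"

abbreviation sd :: "nat \<Rightarrow> 'a \<Rightarrow> real" where "sd t \<omega> \<equiv> sqrt (pvar t (\<lambda>s. y s \<omega>))"

lemma sets_obs: "sets (obs t) =
    sigma_sets (space M) (\<Union>i\<in>{0..t}. {y i -` A \<inter> space M | A. A \<in> sets borel})"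
  and space_obs [simp]: "space (obs t) = space M"
  unfolding gen_sigma_def by (rule sets_measure_of space_measure_of; auto)+

lemma output_obs: "s \<le> t \<Longrightarrow> y s \<in> borel_measurable (obs t)"
proof (rule measurableI)
  fix A :: "real set" assume "s \<le> t" "A \<in> sets borel"
  then show "y s -` A \<inter> space (obs t) \<in> sets (obs t)"
    unfolding sets_obs space_obs by (intro sigma_sets.Basic UN_I[of s]) auto
qed simp

lemma obs_subalgebra: "subalgebra M (obs t)"
  unfolding subalgebra_def sets_obs by (auto intro!: sets.sigma_sets_subset)

lemma pvar_obs [measurable]: "(\<lambda>\<omega>. pvar t (\<lambda>s. y s \<omega>)) \<in> borel_measurable (obs t)"
  by (intro pvar_measurable output_obs)

lemma sd_hist: "sqrt (pvar t (hist t \<omega>)) = sd t \<omega>"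
  using pvar_cong[of t "hist t \<omega>" "\<lambda>s. y s \<omega>"] by (simp add: hist_def)

text \<open>Test events for conditional expectations thereby become indicators of histories, the
  form \<open>predictive_law\<close> can integrate.\<close>

lemma obs_hist:
  assumes "A \<in> sets (obs t)"
  shows "\<exists>B\<in>sets (histories t). A = hist t -` B \<inter> space M"
proof -
  have "sets (obs t) \<subseteq> sets (vimage_algebra (space M) (hist t) (histories t))"
    unfolding sets_obs
  proof (rule sets.sigma_sets_subset[of _ "vimage_algebra (space M) (hist t) (histories t)", simplified], safe)
    fix i and A :: "real set" assume i: "i \<in> {0..t}" and A: "A \<in> sets borel"
    have "(\<lambda>H. H i) -` A \<inter> space (histories t) \<in> sets (histories t)"
      using i by (intro measurable_sets[OF _ A] measurable_component_singleton) auto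
    moreover have "y i -` A \<inter> space M = hist t -` ((\<lambda>H. H i) -` A \<inter> space (histories t)) \<inter> space M"
      using i measurable_space[OF hist_measurable] by (auto simp: hist_def space_PiM)
    ultimately show "y i -` A \<inter> space M \<in> sets (vimage_algebra (space M) (hist t) (histories t))"
      by (metis in_vimage_algebra)
  qed
  moreover have "hist t \<in> space M \<rightarrow> space (histories t)"
    using measurable_space[OF hist_measurable] by auto
  ultimately show ?thesis using assms by (auto simp: sets_vimage_algebra2)
qed

sublocale obs: finite_measure_subalgebra M "obs t" for t
  by standard (rule obs_subalgebra)

lemma cond_exp_output:
  assumes [measurable]: "g \<in> borel_measurable borel"
  shows "AE \<omega> in M. nn_cond_exp M (obs t) (\<lambda>\<omega>. g (y (Suc t) \<omega>)) \<omega> =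
    (\<integral>\<^sup>+ c. ennreal (normal_density 0 (sd t \<omega>) c) * g c \<partial>lborel)"
proof -
  have "AE \<omega> in M. (\<integral>\<^sup>+ c. ennreal (normal_density 0 (sd t \<omega>) c) * g c \<partial>lborel) =
    nn_cond_exp M (obs t) (\<lambda>\<omega>. g (y (Suc t) \<omega>)) \<omega>"
  proof (rule obs.nn_cond_exp_charact)
    show "(\<lambda>\<omega>. \<integral>\<^sup>+ c. ennreal (normal_density 0 (sd t \<omega>) c) * g c \<partial>lborel) \<in> borel_measurable (obs t)"
      unfolding normal_density_def by measurable
    fix A assume "A \<in> sets (obs t)"
    then obtain B where [measurable]: "B \<in> sets (histories t)" and A: "A = hist t -` B \<inter> space M"
      using obs_hist by blast
    \<comment> \<open>The new coordinate enters through \<open>g\<close>, the earlier ones through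
      the test event, so both become one function of the longer history.\<close>
    define k :: "(nat \<Rightarrow> real) \<Rightarrow> ennreal" where "k H = g (H (Suc t)) * indicator B (restrict H {..t})" for H
    have [measurable]: "(\<lambda>H. restrict H {..t}) \<in> measurable (histories (Suc t)) (histories t)"
      by (rule measurable_restrict_subset) auto
    have km: "k \<in> borel_measurable (histories (Suc t))"
      unfolding k_def by measurable
    have r: "restrict (hist (Suc t) \<omega>) {..t} = hist t \<omega>" "restrict ((hist t \<omega>)(Suc t := c)) {..t} = hist t \<omega>" for \<omega> c
      by (auto simp: hist_def fun_eq_iff)
    have "(\<integral>\<^sup>+ \<omega>\<in>A. g (y (Suc t) \<omega>) \<partial>M) = (\<integral>\<^sup>+ \<omega>. k (hist (Suc t) \<omega>) \<partial>M)"
      unfolding k_def r by (intro nn_integral_cong) (auto simp: A hist_def indicator_def)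
    also have "\<dots> = (\<integral>\<^sup>+ \<omega>. \<integral>\<^sup>+ c. ennreal (normal_density 0 (sd t \<omega>) c) *
       (g c * indicator B (hist t \<omega>)) \<partial>lborel \<partial>M)"
      unfolding predictive_law[OF km] sd_hist unfolding k_def r by simp
    also have "\<dots> = (\<integral>\<^sup>+ \<omega>\<in>A. (\<integral>\<^sup>+ c. ennreal (normal_density 0 (sd t \<omega>) c) * g c \<partial>lborel) \<partial>M)"
      by (intro nn_integral_cong) (auto simp: A indicator_def)
    finally show "(\<integral>\<^sup>+ \<omega>\<in>A. g (y (Suc t) \<omega>) \<partial>M) =
      (\<integral>\<^sup>+ \<omega>\<in>A. (\<integral>\<^sup>+ c. ennreal (normal_density 0 (sd t \<omega>) c) * g c \<partial>lborel) \<partial>M)" .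
  qed measurable
  then show ?thesis by eventually_elim simp
qed

section \<open>Visit frequencies and the growth of information\<close>

lemma sd_ge: "\<sigma> \<le> sd t \<omega>"
  using pvar_ge sigma_pos by (intro real_le_rsqrt) auto

lemma sd_pos: "sd t \<omega> > 0"
  using pvar_pos by simp

text \<open>By symmetry the positive and negative parts of the output have the same conditional expectation,
  so \<^const>\<open>real_cond_exp\<close> vanishes without any integrability of the output.\<close>

lemma cond_sd_eq: "AE \<omega> in M. cond_sd M y t \<omega> = sd t \<omega>"
proof -
  have sym: "(\<integral>\<^sup>+ c. ennreal (normal_density 0 s c) * ennreal (- c) \<partial>lborel) =
      (\<integral>\<^sup>+ c. ennreal (normal_density 0 s c) * ennreal c \<partial>lborel)" for s
    using nn_integral_real_affine[of "\<lambda>c. ennreal (normal_density 0 s c) * ennreal c" "-1" 0]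
    by (simp add: normal_density_def)
  have "AE \<omega> in M. real_cond_exp M (obs t) (y (Suc t)) \<omega> = 0"
    using cond_exp_output[of ennreal t, OF measurable_ennreal]
      cond_exp_output[of "\<lambda>c. ennreal (- c)" t, simplified sym, OF measurable_compose[OF _ measurable_ennreal]]
    by (auto simp: real_cond_exp_def)
  then have "AE \<omega> in M. ennreal ((y (Suc t) \<omega> - real_cond_exp M (obs t) (y (Suc t)) \<omega>)\<^sup>2) =
      ennreal ((y (Suc t) \<omega>)\<^sup>2)"
    by eventually_elim simp
  then have "AE \<omega> in M. cond_var M (obs t) (y (Suc t)) \<omega> =
      nn_cond_exp M (obs t) (\<lambda>\<omega>. ennreal ((y (Suc t) \<omega>)\<^sup>2)) \<omega>"
    unfolding cond_var_def by (rule obs.nn_cond_exp_cong) measurable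
  moreover have "AE \<omega> in M. nn_cond_exp M (obs t) (\<lambda>\<omega>. ennreal ((y (Suc t) \<omega>)\<^sup>2)) \<omega> =
      (\<integral>\<^sup>+ c. ennreal (normal_density 0 (sd t \<omega>) c) * ennreal (c\<^sup>2) \<partial>lborel)"
    by (rule cond_exp_output) measurable
  ultimately show ?thesis
  proof eventually_elim
    case (elim \<omega>)
    have "has_bochner_integral lborel (\<lambda>c. normal_density 0 (sd t \<omega>) c * c\<^sup>2) ((sd t \<omega>)\<^sup>2)"
      using normal_moment_even[OF sd_pos, of 0 t \<omega> 1] by (simp add: eval_nat_numeral)
    then have "(\<integral>\<^sup>+ c. ennreal (normal_density 0 (sd t \<omega>) c * c\<^sup>2) \<partial>lborel) = ennreal ((sd t \<omega>)\<^sup>2)"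
      by (subst nn_integral_eq_integral) (simp_all add: has_bochner_integral_iff)
    then have "cond_var M (obs t) (y (Suc t)) \<omega> = ennreal ((sd t \<omega>)\<^sup>2)"
      using elim by (simp only: ennreal_mult normal_density_nonneg zero_le_power2)
    then show ?case unfolding cond_sd_def using less_imp_le[OF sd_pos[of t \<omega>]]
      by (simp only: enn2real_ennreal zero_le_power2 real_sqrt_unique real_sqrt_abs abs_of_nonneg)
  qed
qed

text \<open>An explicit version, defined everywhere, of the conditional probability of a visit to
  \<open>U\<close>; \<open>enn2real\<close> is harmless since the integral is at most 1.\<close>

definition hit_prob :: "real set \<Rightarrow> nat \<Rightarrow> 'a \<Rightarrow> real" where
  "hit_prob U t \<omega> = enn2real (\<integral>\<^sup>+ c. ennreal (normal_density 0 (sd t \<omega>) c) * indicator U c \<partial>lborel)"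

lemma hit_integral_le_1:
  "(\<integral>\<^sup>+ c. ennreal (normal_density 0 (sd t \<omega>) c) * indicator U c \<partial>lborel) \<le> 1"
proof -
  have "(\<integral>\<^sup>+ c. ennreal (normal_density 0 (sd t \<omega>) c) * indicator U c \<partial>lborel) \<le>
      (\<integral>\<^sup>+ c. ennreal (normal_density 0 (sd t \<omega>) c) \<partial>lborel)"
    by (intro nn_integral_mono) (auto simp: indicator_def)
  then show ?thesis by (simp only: normal_density_integral[OF sd_pos])
qed

lemma hit_prob_bounds: "0 \<le> hit_prob U t \<omega>" "hit_prob U t \<omega> \<le> 1"
  unfolding hit_prob_def using enn2real_mono[OF hit_integral_le_1] by auto

lemma hit_prob_measurable:
  assumes [measurable]: "U \<in> sets borel"
  shows "hit_prob U t \<in> borel_measurable (obs t)"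
  unfolding hit_prob_def normal_density_def by measurable

lemma cond_prob_hit:
  assumes [measurable]: "U \<in> sets borel"
  shows "AE \<omega> in M. real_cond_exp M (obs t) (\<lambda>\<omega>. indicator U (y (Suc t) \<omega>)) \<omega> = hit_prob U t \<omega>"
proof -
  have "AE \<omega> in M. nn_cond_exp M (obs t) (\<lambda>\<omega>. ennreal (indicator U (y (Suc t) \<omega>))) \<omega> =
      (\<integral>\<^sup>+ c. ennreal (normal_density 0 (sd t \<omega>) c) * ennreal (indicator U c) \<partial>lborel)"
    by (rule cond_exp_output) measurable
  moreover have "AE \<omega> in M. nn_cond_exp M (obs t) (\<lambda>\<omega>. ennreal (- indicator U (y (Suc t) \<omega>))) \<omega> =
      (\<integral>\<^sup>+ c. ennreal (normal_density 0 (sd t \<omega>) c) * ennreal (- indicator U c) \<partial>lborel)"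
    by (rule cond_exp_output) measurable
  ultimately show ?thesis
    by eventually_elim (simp add: real_cond_exp_def hit_prob_def ennreal_neg ennreal_indicator)
qed

text \<open>Centred by their conditional probabilities, the indicators are bounded martingale
  differences: conditioning the later factor on \<open>obs j\<close> annihilates the expectation of
  the product.\<close>

lemma hit_frequency:
  assumes [measurable]: "U \<in> sets borel"
  shows "AE \<omega> in M. (\<lambda>t. (\<Sum>i<t. indicator U (y (Suc i) \<omega>) - hit_prob U i \<omega>) / real t) \<longlonglongrightarrow> 0"
proof (rule orthogonal_strong_law)
  have [measurable]: "hit_prob U i \<in> borel_measurable M" for i
    using measurable_from_subalg[OF obs_subalgebra hit_prob_measurable[OF assms]] .
  show "(\<lambda>\<omega>. indicator U (y (Suc i) \<omega>) - hit_prob U i \<omega>) \<in> borel_measurable M" for i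
    by measurable
  show b: "\<bar>indicator U (y (Suc i) \<omega>) - hit_prob U i \<omega>\<bar> \<le> 1" for i \<omega>
    using hit_prob_bounds[of U i \<omega>] by (auto simp: indicator_def)
  fix i j :: nat assume ij: "i < j"
  define X where "X \<omega> = indicator U (y (Suc i) \<omega>) - hit_prob U i \<omega>" for \<omega>
  have X: "X \<in> borel_measurable (obs j)"
  proof -
    \<comment> \<open>Here \<open>i < j\<close> is what is needed: \<open>y (Suc i)\<close> is
      already observed at time \<open>j\<close>.\<close>
    have [measurable]: "y (Suc i) \<in> borel_measurable (obs j)" using ij by (intro output_obs) simp
    have "(\<lambda>\<omega>. pvar i (\<lambda>s. y s \<omega>)) \<in> borel_measurable (obs j)"
      using ij by (intro pvar_measurable output_obs) simp
    then have [measurable]: "hit_prob U i \<in> borel_measurable (obs j)"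
      unfolding hit_prob_def normal_density_def by measurable
    show ?thesis unfolding X_def by measurable
  qed
  have [measurable]: "X \<in> borel_measurable M" using measurable_from_subalg[OF obs_subalgebra X] .
  have i1: "integrable M (\<lambda>\<omega>. X \<omega> * indicator U (y (Suc j) \<omega>))"
    using b[of i] by (intro integrable_const_bound[where B=1]) (auto simp: X_def indicator_def)
  have i2: "integrable M (\<lambda>\<omega>. X \<omega> * hit_prob U j \<omega>)"
    using b[of i] hit_prob_bounds by (intro integrable_const_bound[where B=1])
      (auto simp: X_def abs_mult intro!: mult_le_one)
  have "expectation (\<lambda>\<omega>. X \<omega> * indicator U (y (Suc j) \<omega>)) =
      expectation (\<lambda>\<omega>. X \<omega> * real_cond_exp M (obs j) (\<lambda>\<omega>. indicator U (y (Suc j) \<omega>)) \<omega>)"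
    by (rule obs.real_cond_exp_intg(2)[symmetric, OF i1 X]) measurable
  also have "\<dots> = expectation (\<lambda>\<omega>. X \<omega> * hit_prob U j \<omega>)"
    using cond_prob_hit[OF assms, of j]
    by (intro integral_cong_AE) (auto intro: measurable_from_subalg[OF obs_subalgebra])
  finally have "expectation (\<lambda>\<omega>. X \<omega> * (indicator U (y (Suc j) \<omega>) - hit_prob U j \<omega>)) = 0"
    using i1 i2 by (simp add: right_diff_distrib)
  then show "expectation (\<lambda>\<omega>. (indicator U (y (Suc i) \<omega>) - hit_prob U i \<omega>) *
      (indicator U (y (Suc j) \<omega>) - hit_prob U j \<omega>)) = 0" by (simp add: X_def)
qed

text \<open>On the interval the exponent of the density is bounded using
  \<open>\<bar>c\<bar> \<le> R\<close> and \<open>\<sigma> \<le> sd\<close>, while the prefactor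
  keeps its \<open>1 / sd\<close>; the interval has length \<open>2 * r\<close>.\<close>

lemma hit_prob_ge:
  assumes r: "r > 0" and R: "\<bar>s\<bar> + r \<le> R"
  shows "2 * r * exp (- R\<^sup>2 / (2 * \<sigma>\<^sup>2)) / sqrt (2 * pi) / sd t \<omega> \<le> hit_prob {s - r<..<s + r} t \<omega>"
proof -
  let ?U = "{s - r<..<s + r}" and ?sd = "sd t \<omega>"
  define d where "d = exp (- R\<^sup>2 / (2 * \<sigma>\<^sup>2)) / sqrt (2 * pi) / ?sd"
  have d: "d \<ge> 0" using sd_pos[of t \<omega>] by (simp add: d_def)
  have "d \<le> normal_density 0 ?sd c" if "c \<in> ?U" for c
  proof -
    have "\<bar>c\<bar> \<le> R" using that R by auto
    then have "c\<^sup>2 \<le> R\<^sup>2" by (metis abs_ge_zero order_trans power2_abs power_mono)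
    moreover have "\<sigma>\<^sup>2 \<le> ?sd\<^sup>2" using sd_ge[of t \<omega>] sigma_pos by (intro power_mono) auto
    ultimately have "c\<^sup>2 / (2 * ?sd\<^sup>2) \<le> R\<^sup>2 / (2 * \<sigma>\<^sup>2)"
      using sigma_pos by (intro frac_le) auto
    then have "exp (- R\<^sup>2 / (2 * \<sigma>\<^sup>2)) / (sqrt (2 * pi) * ?sd) \<le> exp (- c\<^sup>2 / (2 * ?sd\<^sup>2)) / (sqrt (2 * pi) * ?sd)"
      using sd_pos[of t \<omega>] by (intro divide_right_mono) auto
    also have "sqrt (2 * pi) * ?sd = sqrt (2 * pi * ?sd\<^sup>2)"
      using sd_pos[of t \<omega>] by (simp only: real_sqrt_mult real_sqrt_abs abs_of_pos)
    finally show ?thesis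
      using sd_pos[of t \<omega>] by (simp add: normal_density_def d_def real_sqrt_mult)
  qed
  then have "(\<integral>\<^sup>+ c. ennreal d * indicator ?U c \<partial>lborel) \<le>
      (\<integral>\<^sup>+ c. ennreal (normal_density 0 ?sd c) * indicator ?U c \<partial>lborel)"
    by (intro nn_integral_mono) (auto simp: indicator_def intro!: ennreal_leI)
  also have "(\<integral>\<^sup>+ c. ennreal d * indicator ?U c \<partial>lborel) = ennreal (d * (2 * r))"
    using r d by (simp add: nn_integral_cmult ennreal_mult)
  finally have "enn2real (ennreal (d * (2 * r))) \<le> hit_prob ?U t \<omega>"
    unfolding hit_prob_def using hit_integral_le_1[of t \<omega> ?U]
    by (intro enn2real_mono) (auto simp: le_less_trans[OF _ ennreal_one_less_top])
  then have "d * (2 * r) \<le> hit_prob ?U t \<omega>" using r d by simp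
  then show ?thesis by (simp add: d_def mult_ac)
qed

text \<open>Splits into the inequality \<open>lower\<close>, valid for every path and time, and the
  almost sure statement that its error terms vanish after division by \<open>t\<close>. The constant
  is \<open>K * \<kappa>\<close>.\<close>

lemma min_eigenvalue_growth:
  assumes "open E" "continuous_on E \<phi>" "lin_indep_on E \<phi>"
  shows "\<exists>C>0. AE \<omega> in M.
    liminf (\<lambda>t. ereal (min_eigenvalue (prec (Suc t) (\<lambda>s. y s \<omega>)) / real t))
      \<ge> ereal C * liminf (\<lambda>t. ereal ((1 / real t) * (\<Sum>i=1..t. 1 / cond_sd M y (i - 1) \<omega>)))"
proof -
  obtain T r \<delta> where T: "finite T" and r: "r > 0" and \<delta>: "\<delta> > 0"
    and ex: "\<And>x. norm x = 1 \<Longrightarrow> \<exists>s\<in>T. \<forall>z. \<bar>z - s\<bar> < r \<longrightarrow> \<delta> \<le> \<bar>x \<bullet> \<phi> z\<bar>"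
    using excitation[OF assms] by blast
  define U where "U s = {s - r<..<s + r}" for s
  \<comment> \<open>A common bound for all the intervals, so that \<open>\<kappa>\<close> does not
    depend on \<open>s\<close>.\<close>
  define R where "R = (\<Sum>s\<in>T. \<bar>s\<bar>) + r"
  define \<kappa> where "\<kappa> = 2 * r * exp (- R\<^sup>2 / (2 * \<sigma>\<^sup>2)) / sqrt (2 * pi)"
  define K where "K = \<delta>\<^sup>2 / \<sigma>\<^sup>2"
  define dev where "dev s t \<omega> = (\<Sum>i<t. indicator (U s) (y (Suc i) \<omega>) - hit_prob (U s) i \<omega>)" for s t \<omega>
  have K: "K > 0" and \<kappa>: "\<kappa> > 0" using \<delta> sigma_pos r by (simp_all add: K_def \<kappa>_def)
  have lower: "K * (\<kappa> * (\<Sum>i<t. 1 / sd i \<omega>) - (\<Sum>s\<in>T. \<bar>dev s t \<omega>\<bar>))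
      \<le> min_eigenvalue (prec (Suc t) (\<lambda>s. y s \<omega>))" for t \<omega>
  proof (rule min_eigenvalue_ge[OF prec_sym])
    fix x :: "real ^ 'n" assume "norm x = 1"
    then obtain s where s: "s \<in> T" "\<And>z. \<bar>z - s\<bar> < r \<Longrightarrow> \<delta> \<le> \<bar>x \<bullet> \<phi> z\<bar>" using ex by blast
    have "\<bar>s\<bar> + r \<le> R" using member_le_sum[of s T abs] s T by (simp add: R_def)
    then have "\<kappa> / sd i \<omega> \<le> hit_prob (U s) i \<omega>" for i
      unfolding \<kappa>_def U_def by (rule hit_prob_ge[OF r])
    then have "\<kappa> * (\<Sum>i<t. 1 / sd i \<omega>) \<le> (\<Sum>i<t. hit_prob (U s) i \<omega>)"
      unfolding sum_distrib_left by (intro sum_mono) simp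
    moreover have "(\<Sum>i<t. indicator (U s) (y (Suc i) \<omega>)) = (\<Sum>i<t. hit_prob (U s) i \<omega>) + dev s t \<omega>"
      by (simp add: dev_def sum_subtractf)
    \<comment> \<open>The interval \<open>s\<close> depends on \<open>x\<close>; the sum over all of
      \<open>T\<close> makes the error independent of \<open>x\<close>.\<close>
    moreover have "- dev s t \<omega> \<le> (\<Sum>s\<in>T. \<bar>dev s t \<omega>\<bar>)"
      using member_le_sum[of s T "\<lambda>s. \<bar>dev s t \<omega>\<bar>"] s T by simp
    ultimately have "\<kappa> * (\<Sum>i<t. 1 / sd i \<omega>) - (\<Sum>s\<in>T. \<bar>dev s t \<omega>\<bar>)
        \<le> (\<Sum>i<t. indicator (U s) (y (Suc i) \<omega>))" by linarith
    then have "K * (\<kappa> * (\<Sum>i<t. 1 / sd i \<omega>) - (\<Sum>s\<in>T. \<bar>dev s t \<omega>\<bar>))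
        \<le> K * (\<Sum>i<t. indicator (U s) (y (Suc i) \<omega>))" using K by simp
    also have "\<dots> = (\<Sum>i<t. \<delta>\<^sup>2 * indicator (U s) (y (Suc i) \<omega>)) / \<sigma>\<^sup>2"
      unfolding K_def sum_distrib_left sum_divide_distrib by (intro sum.cong) simp_all
    also have "\<dots> \<le> (\<Sum>i<t. (x \<bullet> \<phi> (y (Suc i) \<omega>))\<^sup>2) / \<sigma>\<^sup>2"
    proof (intro divide_right_mono sum_mono)
      fix i
      show "\<delta>\<^sup>2 * indicator (U s) (y (Suc i) \<omega>) \<le> (x \<bullet> \<phi> (y (Suc i) \<omega>))\<^sup>2"
      proof (cases "y (Suc i) \<omega> \<in> U s")
        case True
        then have "\<bar>y (Suc i) \<omega> - s\<bar> < r" by (auto simp: U_def)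
        then have "\<delta>\<^sup>2 \<le> \<bar>x \<bullet> \<phi> (y (Suc i) \<omega>)\<bar>\<^sup>2" using \<delta> by (intro power_mono s) auto
        then show ?thesis using True by simp
      qed simp
    qed simp
    \<comment> \<open>The precision at \<open>Suc t\<close> contains the regressors at times 0 to
      \<open>t\<close>. The term of the initial output and \<open>x \<bullet> x\<close> are dropped,
      leaving the \<open>t\<close> outputs whose visits are counted.\<close>
    also have "\<dots> \<le> x \<bullet> (prec (Suc t) (\<lambda>s. y s \<omega>) *v x)"
      unfolding prec_quadratic sum.lessThan_Suc_shift
      by (simp add: add_divide_distrib)
    finally show "K * (\<kappa> * (\<Sum>i<t. 1 / sd i \<omega>) - (\<Sum>s\<in>T. \<bar>dev s t \<omega>\<bar>))
        \<le> x \<bullet> (prec (Suc t) (\<lambda>s. y s \<omega>) *v x)" .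
  qed
  have "AE \<omega> in M. \<forall>t. cond_sd M y t \<omega> = sd t \<omega>"
    unfolding AE_all_countable using cond_sd_eq by blast
  moreover have "AE \<omega> in M. \<forall>s\<in>T. (\<lambda>t. dev s t \<omega> / real t) \<longlonglongrightarrow> 0"
    unfolding dev_def using T by (intro AE_finite_allI hit_frequency) (auto simp: U_def)
  ultimately have "AE \<omega> in M.
    liminf (\<lambda>t. ereal (min_eigenvalue (prec (Suc t) (\<lambda>s. y s \<omega>)) / real t))
      \<ge> ereal (K * \<kappa>) * liminf (\<lambda>t. ereal ((1 / real t) * (\<Sum>i=1..t. 1 / cond_sd M y (i - 1) \<omega>)))"
  proof eventually_elim
    case (elim \<omega>)
    define a where "a t = (1 / real t) * (\<Sum>i=1..t. 1 / cond_sd M y (i - 1) \<omega>)" for t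
    define e where "e t = - K * (\<Sum>s\<in>T. \<bar>dev s t \<omega> / real t\<bar>)" for t
    have a: "a t = (1 / real t) * (\<Sum>i<t. 1 / sd i \<omega>)" for t
      using elim(1) by (simp add: a_def sum.atLeast1_atMost_eq)
    have "e \<longlonglongrightarrow> - K * (\<Sum>s\<in>T. \<bar>0\<bar>)"
      unfolding e_def using elim(2) by (intro tendsto_intros) auto
    then have e: "(\<lambda>t. ereal (e t)) \<longlonglongrightarrow> 0" by (simp add: zero_ereal_def)
    have "ereal (K * \<kappa>) * liminf (\<lambda>t. ereal (a t)) = 0 + liminf (\<lambda>t. ereal (K * \<kappa>) * ereal (a t))"
      using K \<kappa> by (subst Liminf_ereal_mult_left) auto
    \<comment> \<open>A summand with a finite limit splits off a liminf with equality.\<close>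
    also have "\<dots> = liminf (\<lambda>t. ereal (e t) + ereal (K * \<kappa>) * ereal (a t))"
      by (rule ereal_liminf_lim_add[OF e, symmetric]) simp
    also have "\<dots> \<le> liminf (\<lambda>t. ereal (min_eigenvalue (prec (Suc t) (\<lambda>s. y s \<omega>)) / real t))"
    proof (rule Liminf_mono, rule always_eventually, rule allI)
      fix t
      have "e t + K * \<kappa> * a t =
          (K * (\<kappa> * (\<Sum>i<t. 1 / sd i \<omega>) - (\<Sum>s\<in>T. \<bar>dev s t \<omega>\<bar>))) / real t"
        by (simp add: a e_def sum_divide_distrib[symmetric] right_diff_distrib diff_divide_distrib)
      also have "\<dots> \<le> min_eigenvalue (prec (Suc t) (\<lambda>s. y s \<omega>)) / real t"
        by (intro divide_right_mono lower) simp
      finally show "ereal (e t) + ereal (K * \<kappa>) * ereal (a t) \<le>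
          ereal (min_eigenvalue (prec (Suc t) (\<lambda>s. y s \<omega>)) / real t)" by simp
    qed
    finally show ?case by (simp add: a_def)
  qed
  then show ?thesis using K \<kappa> by (intro exI[of _ "K * \<kappa>"]) simp
qed

end

theorem proposition3p1:
  fixes M :: "'a measure"
    and \<phi> :: "real \<Rightarrow> real ^ 'n"
    and E :: "real set"
    and \<sigma> y0 :: real
    and \<theta>0 :: "real ^ 'n"
    and \<theta> :: "'a \<Rightarrow> real ^ 'n"
    and w y u :: "nat \<Rightarrow> 'a \<Rightarrow> real"
    and \<theta>h :: "nat \<Rightarrow> 'a \<Rightarrow> real ^ 'n"
    and P :: "nat \<Rightarrow> 'a \<Rightarrow> real ^ 'n ^ 'n"
  assumes "prob_space M"
    and "CARD('n) \<ge> 2"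
    and "\<phi> \<in> borel_measurable borel"
    and "open E"
    and "\<And>j. Ck_on CARD('n) (\<lambda>x. \<phi> x $ j) E"
    and A1: "\<sigma> > 0"
      "prob_space.indep_vars M (\<lambda>_. borel) w {1..}"
      "\<And>t. t \<ge> 1 \<Longrightarrow> distributed M lborel (w t) (normal_density 0 \<sigma>)"
    and A2: "distributed M lborel \<theta> (std_normal_vec_density \<theta>0)"
      "prob_space.indep_set M (sets (vimage_algebra (space M) \<theta> borel))
         (sets (gen_sigma M w {1..}))"
    and A3: "lin_indep_on E \<phi>"
    and "closed_loop M \<phi> \<sigma> \<theta>0 y0 \<theta> w y u \<theta>h P"
  shows "\<exists>C>0. AE \<omega> in M.
    liminf (\<lambda>t. ereal (min_eigenvalue (matrix_inv (P (Suc t) \<omega>)) / real t))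
      \<ge> ereal C * liminf (\<lambda>t. ereal ((1 / real t) * (\<Sum>i=1..t. 1 / cond_sd M y (i - 1) \<omega>)))"
proof -
  interpret prob_space M by fact
  interpret regulator \<phi> \<sigma> \<theta>0 by standard fact+
  have loop: "y 0 \<omega> = y0" "\<theta>h 0 \<omega> = \<theta>0" "P 0 \<omega> = mat 1"
    "u t \<omega> = - (\<theta>h t \<omega> \<bullet> \<phi> (y t \<omega>))"
    "y (Suc t) \<omega> = \<theta> \<omega> \<bullet> \<phi> (y t \<omega>) + u t \<omega> + w (Suc t) \<omega>"
    "P (Suc t) \<omega> = P t \<omega> - inverse (\<sigma>\<^sup>2 + \<phi> (y t \<omega>) \<bullet> (P t \<omega> *v \<phi> (y t \<omega>))) *\<^sub>R
       (P t \<omega> ** outer_prod (\<phi> (y t \<omega>)) (\<phi> (y t \<omega>)) ** P t \<omega>)"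
    "\<theta>h (Suc t) \<omega> = \<theta>h t \<omega> + (inverse (\<sigma>\<^sup>2) * (y (Suc t) \<omega> - u t \<omega> - \<phi> (y t \<omega>) \<bullet> \<theta>h t \<omega>)) *\<^sub>R
       (P (Suc t) \<omega> *v \<phi> (y t \<omega>))"
    if "\<omega> \<in> space M" for \<omega> t
    using assms(12) that unfolding closed_loop_def Let_def by blast+
  have P: "P t \<omega> = cov t (\<lambda>s. y s \<omega>)" if "\<omega> \<in> space M" for t \<omega>
    by (induction t) (simp_all add: loop(3,6)[OF that])
  have \<theta>h: "\<theta>h t \<omega> = est t (\<lambda>s. y s \<omega>)" if "\<omega> \<in> space M" for t \<omega>
  proof (induction t)
    case (Suc t)
    \<comment> \<open>The control cancels the prediction, so the least-squares recursion coincides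
      with that of \<open>est\<close>.\<close>
    have "y (Suc t) \<omega> - u t \<omega> - \<phi> (y t \<omega>) \<bullet> \<theta>h t \<omega> = y (Suc t) \<omega>"
      by (simp add: loop(4)[OF that] inner_commute)
    then show ?case using Suc unfolding loop(7)[OF that] P[OF that] by (simp del: cov.simps)
  qed (simp add: loop(2)[OF that])
  interpret closed_loop_system M \<phi> \<sigma> \<theta>0 y0 \<theta> w y
  proof
    fix t \<omega> assume \<omega>: "\<omega> \<in> space M"
    show "y (Suc t) \<omega> = (\<theta> \<omega> - est t (\<lambda>s. y s \<omega>)) \<bullet> \<phi> (y t \<omega>) + w (Suc t) \<omega>"
      unfolding loop(5)[OF \<omega>] loop(4)[OF \<omega>] \<theta>h[OF \<omega>] by (simp add: inner_diff_left)
  qed (use A1 A2 loop(1) in auto)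
  have "continuous_on E (\<lambda>x. \<phi> x $ j)" for j
    using assms(5)[of j] unfolding Ck_on_def by (metis funpow_0 le0)
  then have "continuous_on E (\<lambda>x. \<chi> j. \<phi> x $ j)" by (rule continuous_on_vec_lambda)
  then have "continuous_on E \<phi>" by simp
  from min_eigenvalue_growth[OF assms(4) this A3] obtain C where "C > 0" and
    "AE \<omega> in M. liminf (\<lambda>t. ereal (min_eigenvalue (prec (Suc t) (\<lambda>s. y s \<omega>)) / real t))
      \<ge> ereal C * liminf (\<lambda>t. ereal ((1 / real t) * (\<Sum>i=1..t. 1 / cond_sd M y (i - 1) \<omega>)))" by blast
  from this(2) have "AE \<omega> in M.
    liminf (\<lambda>t. ereal (min_eigenvalue (matrix_inv (P (Suc t) \<omega>)) / real t))
      \<ge> ereal C * liminf (\<lambda>t. ereal ((1 / real t) * (\<Sum>i=1..t. 1 / cond_sd M y (i - 1) \<omega>)))"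
    by (rule AE_mp) (simp add: P matrix_inv_cov del: cov.simps prec.simps)
  then show ?thesis using \<open>C > 0\<close> by blast
qed

end
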